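(* Let $h_1,h_2>0$, $\Omega=(-\frac{h_1}2,\frac{h_1}2)\times(-\frac{h_2}2,\frac{h_2}2)\subset\mathbb{R}^2$ and $\Gamma=\partial\Omega$. Then the sharp constant $C_1(\Omega,\Gamma)$ is equal to $\frac1\pi\max\{h_1;h_2\}$.
   Context: For a bounded connected Lipschitz domain $\Omega\subset\mathbb{R}^d$ and a measurable part $\Gamma\subset\partial\Omega$ of positive $(d-1)$-dimensional measure, let $\widetilde H^1(\Omega,\Gamma)=\{w\in H^1(\Omega): \text{the mean value of (the trace of) } w \text{ on } \Gamma \text{ is zero}\}$. The norm in $L^2(\omega)$ is denoted $\|\cdot\|_{2,\omega}$. The sharp constant $C_1(\Omega,\Gamma)$ is the smallest constant $C$ such that $\|w\|_{2,\Omega}\le C\|\nabla w\|_{2,\Omega}$ for all $w\in\widetilde H^1(\Omega,\Gamma)$. *)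

theory Defs
  imports "HOL-Analysis.Analysis"
begin
definition hausdorff_cost :: "nat \<Rightarrow> 'a::metric_space set \<Rightarrow> ennreal" where
  "hausdorff_cost s U =
     (if U = {} then 0 else ennreal (unit_ball_vol (real s) * (diameter U / 2) ^ s))"

text \<open>
  The boundedness condition is needed because \<^const>\<open>diameter\<close> is unspecified on unbounded sets.
\<close>

definition hausdorff_content :: "nat \<Rightarrow> real \<Rightarrow> 'a::metric_space set \<Rightarrow> ennreal" where
  "hausdorff_content s \<delta> A =
     (INF U\<in>{U :: nat \<Rightarrow> 'a set. A \<subseteq> (\<Union>i. U i) \<and> (\<forall>i. bounded (U i) \<and> diameter (U i) \<le> \<delta>)}.
        \<Sum>i. hausdorff_cost s (U i))"

definition hausdorff_outer :: "nat \<Rightarrow> 'a::metric_space set \<Rightarrow> ennreal" where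
  "hausdorff_outer s A = (SUP \<delta>\<in>{0<..}. hausdorff_content s \<delta> A)"

text \<open>
  The measure lives on all sets that are measurable in the sense of Caratheodory. The factor
  \<^const>\<open>unit_ball_vol\<close> makes it agree with the usual surface measure on smooth
  \<open>s\<close>-dimensional surfaces.
\<close>

definition hausdorff_measure :: "nat \<Rightarrow> 'a::metric_space measure" where
  "hausdorff_measure s =
     measure_of UNIV (lambda_system UNIV UNIV (hausdorff_outer s)) (hausdorff_outer s)"

lemma hausdorff_content_subadditive:
  fixes A :: "nat \<Rightarrow> 'a::metric_space set"
  assumes "\<delta> > 0"
  shows "hausdorff_content s \<delta> (\<Union>i. A i) \<le> (\<Sum>i. hausdorff_content s \<delta> (A i))"
proof (rule ennreal_le_epsilon)
  fix e :: real assume e: "e > 0" and fin: "(\<Sum>i. hausdorff_content s \<delta> (A i)) < top"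
  let ?C = "\<lambda>A. {U :: nat \<Rightarrow> 'a set. A \<subseteq> (\<Union>i. U i) \<and> (\<forall>i. bounded (U i) \<and> diameter (U i) \<le> \<delta>)}"
  have "\<exists>U\<in>?C (A n). (\<Sum>i. hausdorff_cost s (U i)) \<le> hausdorff_content s \<delta> (A n) + e * (1/2)^Suc n" for n
  proof -
    have "hausdorff_content s \<delta> (A n) < top" using ennreal_suminf_lessD[OF fin] .
    moreover have "0 < ennreal (e * (1/2)^Suc n)" using e by simp
    ultimately have "hausdorff_content s \<delta> (A n) < hausdorff_content s \<delta> (A n) + e * (1/2)^Suc n"
      by (metis ennreal_add_left_cancel_less add.right_neutral infinity_ennreal_def less_irrefl)
    then have "(INF U\<in>?C (A n). \<Sum>i. hausdorff_cost s (U i)) <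
        hausdorff_content s \<delta> (A n) + e * (1/2)^Suc n"
      by (simp only: hausdorff_content_def)
    then show ?thesis
      unfolding INF_less_iff by (blast intro: less_imp_le)
  qed
  then have "\<exists>U. \<forall>n. U n \<in> ?C (A n) \<and>
      (\<Sum>i. hausdorff_cost s (U n i)) \<le> hausdorff_content s \<delta> (A n) + e * (1/2)^Suc n"
    by (intro choice) blast
  then obtain U where U: "\<And>n. U n \<in> ?C (A n)"
    and le: "\<And>n. (\<Sum>i. hausdorff_cost s (U n i)) \<le> hausdorff_content s \<delta> (A n) + e * (1/2)^Suc n"
    by blast
  define V where "V = (\<lambda>k. case_prod U (prod_decode k))"
  have "V \<in> ?C (\<Union>i. A i)"
  proof -
    have "x \<in> (\<Union>k. V k)" if "x \<in> A n" for x n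
    proof -
      have "x \<in> (\<Union>i. U n i)" using U[of n] that by blast
      then obtain i where "x \<in> U n i" by blast
      then show ?thesis unfolding V_def by (auto intro!: exI[of _ "prod_encode (n, i)"])
    qed
    moreover have "bounded (V k) \<and> diameter (V k) \<le> \<delta>" for k
      using U unfolding V_def by (auto split: prod.split)
    ultimately show ?thesis by blast
  qed
  then have "hausdorff_content s \<delta> (\<Union>i. A i) \<le> (\<Sum>k. hausdorff_cost s (V k))"
    unfolding hausdorff_content_def by (rule INF_lower)
  also have "\<dots> = (\<Sum>n. \<Sum>i. hausdorff_cost s (U n i))"
    using suminf_ennreal_2dimen[of "\<lambda>n. \<Sum>i. hausdorff_cost s (U n i)"
        "\<lambda>p. hausdorff_cost s (case_prod U p)"]
    by (simp add: V_def o_def)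
  also have "\<dots> \<le> (\<Sum>n. hausdorff_content s \<delta> (A n) + e * (1/2)^Suc n)"
    by (intro suminf_le le) auto
  also have "\<dots> = (\<Sum>n. hausdorff_content s \<delta> (A n)) + (\<Sum>n. ennreal (e * (1/2)^Suc n))"
    by (rule suminf_add[symmetric]) auto
  also have "(\<Sum>n. ennreal (e * (1/2)^Suc n)) = ennreal e"
    using sums_mult[OF power_half_series, of e] e
    by (intro suminf_ennreal_eq) auto
  finally show "hausdorff_content s \<delta> (\<Union>i. A i) \<le> (\<Sum>n. hausdorff_content s \<delta> (A n)) + ennreal e" .
qed

lemma outer_measure_space_hausdorff_outer: "outer_measure_space UNIV (hausdorff_outer s :: 'a::metric_space set \<Rightarrow> ennreal)"
  unfolding outer_measure_space_def
proof (intro conjI)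
  have "hausdorff_content s \<delta> ({} :: 'a set) = 0" if "\<delta> > 0" for \<delta>
  proof -
    have "hausdorff_content s \<delta> ({} :: 'a set) \<le> (\<Sum>i::nat. hausdorff_cost s ({} :: 'a set))"
      unfolding hausdorff_content_def using that by (intro INF_lower2[of "\<lambda>_. {}"]) auto
    then show ?thesis by (simp add: hausdorff_cost_def)
  qed
  then have "hausdorff_outer s ({} :: 'a set) \<le> 0"
    unfolding hausdorff_outer_def by (intro SUP_least) auto
  then show "positive UNIV (hausdorff_outer s :: 'a set \<Rightarrow> ennreal)"
    by (simp add: positive_def)
  show "increasing UNIV (hausdorff_outer s :: 'a set \<Rightarrow> ennreal)"
    unfolding increasing_def hausdorff_outer_def hausdorff_content_def
    by (intro ballI impI SUP_mono' INF_superset_mono) auto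
  show "countably_subadditive UNIV (hausdorff_outer s :: 'a set \<Rightarrow> ennreal)"
    unfolding countably_subadditive_def
  proof (intro allI impI)
    fix A :: "nat \<Rightarrow> 'a set"
    have "hausdorff_content s \<delta> (\<Union>i. A i) \<le> (\<Sum>i. hausdorff_outer s (A i))" if "\<delta> > 0" for \<delta>
      using hausdorff_content_subadditive[OF that, of s A]
      by (rule order_trans) (auto intro!: suminf_le SUP_upper that simp: hausdorff_outer_def)
    then show "hausdorff_outer s (\<Union>i. A i) \<le> (\<Sum>i. hausdorff_outer s (A i))"
      unfolding hausdorff_outer_def[of s "\<Union>i. A i"] by (auto intro: SUP_least)
  qed
qed

lemma
  fixes A :: "'a::metric_space set"
  shows sets_hausdorff_measure:
      "sets (hausdorff_measure s :: 'a measure) = lambda_system UNIV UNIV (hausdorff_outer s)"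
    and emeasure_hausdorff_measure:
      "A \<in> sets (hausdorff_measure s) \<Longrightarrow> emeasure (hausdorff_measure s) A = hausdorff_outer s A"
proof -
  have "measure_space UNIV (lambda_system UNIV UNIV (hausdorff_outer s :: 'a set \<Rightarrow> ennreal)) (hausdorff_outer s)"
    using sigma_algebra.caratheodory_lemma[OF _ outer_measure_space_hausdorff_outer]
      sigma_algebra_Pow[of UNIV] by simp
  then have *: "sigma_algebra UNIV (lambda_system UNIV UNIV (hausdorff_outer s :: 'a set \<Rightarrow> ennreal))"
      "positive (lambda_system UNIV UNIV (hausdorff_outer s)) (hausdorff_outer s :: 'a set \<Rightarrow> ennreal)"
      "countably_additive (lambda_system UNIV UNIV (hausdorff_outer s)) (hausdorff_outer s :: 'a set \<Rightarrow> ennreal)"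
    by (auto simp: measure_space_def)
  show eq: "sets (hausdorff_measure s :: 'a measure) = lambda_system UNIV UNIV (hausdorff_outer s)"
    unfolding hausdorff_measure_def using *(1) by (simp add: sigma_algebra.sigma_sets_eq)
  show "A \<in> sets (hausdorff_measure s) \<Longrightarrow> emeasure (hausdorff_measure s) A = hausdorff_outer s A"
    unfolding hausdorff_measure_def
    by (rule emeasure_measure_of_sigma[OF *]) (use eq in \<open>simp add: hausdorff_measure_def\<close>)
qed

definition surface_measure :: "'a::euclidean_space set \<Rightarrow> 'a measure" where
  "surface_measure S = restrict_space (hausdorff_measure (DIM('a) - 1)) S"

definition square_integrable :: "'a measure \<Rightarrow> ('a \<Rightarrow> 'b::euclidean_space) \<Rightarrow> bool" where
  "square_integrable M f \<longleftrightarrow> f \<in> borel_measurable M \<and> integrable M (\<lambda>x. (norm (f x))\<^sup>2)"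

definition L2_norm :: "'a measure \<Rightarrow> ('a \<Rightarrow> 'b::euclidean_space) \<Rightarrow> real" where
  "L2_norm M f = sqrt (\<integral>x. (norm (f x))\<^sup>2 \<partial>M)"

definition partial_deriv :: "'a::euclidean_space \<Rightarrow> ('a \<Rightarrow> real) \<Rightarrow> 'a \<Rightarrow> real" where
  "partial_deriv b f x = frechet_derivative f (at x) b"

primrec C_k :: "nat \<Rightarrow> ('a::euclidean_space \<Rightarrow> real) \<Rightarrow> bool" where
  "C_k 0 f \<longleftrightarrow> continuous_on UNIV f"
| "C_k (Suc k) f \<longleftrightarrow> (\<forall>x. f differentiable (at x)) \<and> (\<forall>b\<in>Basis. C_k k (partial_deriv b f))"

definition smooth :: "('a::euclidean_space \<Rightarrow> real) \<Rightarrow> bool" where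
  "smooth f \<longleftrightarrow> (\<forall>k. C_k k f)"

definition test_function :: "'a::euclidean_space set \<Rightarrow> ('a \<Rightarrow> real) \<Rightarrow> bool" where
  "test_function \<Omega> \<phi> \<longleftrightarrow>
     smooth \<phi> \<and> compact (closure {x. \<phi> x \<noteq> 0}) \<and> closure {x. \<phi> x \<noteq> 0} \<subseteq> \<Omega>"

text \<open>
  Functions in \<open>L\<^sup>2\<close> and \<open>H\<^sup>1\<close> are represented by total functions on the whole space of which only
  the values on \<open>\<Omega>\<close> matter.
\<close>

definition has_weak_gradient :: "'a::euclidean_space set \<Rightarrow> ('a \<Rightarrow> real) \<Rightarrow> ('a \<Rightarrow> 'a) \<Rightarrow> bool" where
  "has_weak_gradient \<Omega> w G \<longleftrightarrow>
     square_integrable (lebesgue_on \<Omega>) G \<and>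
     (\<forall>\<phi>. test_function \<Omega> \<phi> \<longrightarrow> (\<forall>b\<in>Basis.
        (\<integral>x. w x * partial_deriv b \<phi> x \<partial>lebesgue_on \<Omega>) =
        - (\<integral>x. (G x \<bullet> b) * \<phi> x \<partial>lebesgue_on \<Omega>)))"

definition H1 :: "'a::euclidean_space set \<Rightarrow> ('a \<Rightarrow> real) set" where
  "H1 \<Omega> = {w. square_integrable (lebesgue_on \<Omega>) w \<and> (\<exists>G. has_weak_gradient \<Omega> w G)}"

text \<open>The weak gradient of \<open>w \<in> H1 \<Omega>\<close> is determined almost everywhere on an open \<open>\<Omega>\<close>.\<close>

definition weak_gradient :: "'a::euclidean_space set \<Rightarrow> ('a \<Rightarrow> real) \<Rightarrow> 'a \<Rightarrow> 'a" where
  "weak_gradient \<Omega> w = (SOME G. has_weak_gradient \<Omega> w G)"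

definition H1_norm :: "'a::euclidean_space set \<Rightarrow> ('a \<Rightarrow> real) \<Rightarrow> real" where
  "H1_norm \<Omega> w =
     sqrt ((L2_norm (lebesgue_on \<Omega>) w)\<^sup>2 + (L2_norm (lebesgue_on \<Omega>) (weak_gradient \<Omega> w))\<^sup>2)"

text \<open>
  The trace operator of a bounded Lipschitz domain is the continuous extension, from \<open>H\<^sup>1(\<Omega>)\<close> to
  \<open>L\<^sup>2(\<partial>\<Omega>)\<close>, of the restriction to \<open>\<partial>\<Omega>\<close> of functions that are smooth up to the boundary. Its graph
  is therefore the closure of the graph of that restriction.
\<close>

definition has_trace :: "'a::euclidean_space set \<Rightarrow> ('a \<Rightarrow> real) \<Rightarrow> ('a \<Rightarrow> real) \<Rightarrow> bool" where
  "has_trace \<Omega> w g \<longleftrightarrow>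
     w \<in> H1 \<Omega> \<and> square_integrable (surface_measure (frontier \<Omega>)) g \<and>
     (\<exists>\<phi> :: nat \<Rightarrow> 'a \<Rightarrow> real.
        (\<forall>k. smooth (\<phi> k) \<and> \<phi> k \<in> H1 \<Omega> \<and>
             square_integrable (surface_measure (frontier \<Omega>)) (\<phi> k)) \<and>
        (\<lambda>k. H1_norm \<Omega> (\<lambda>x. \<phi> k x - w x)) \<longlonglongrightarrow> 0 \<and>
        (\<lambda>k. L2_norm (surface_measure (frontier \<Omega>)) (\<lambda>x. \<phi> k x - g x)) \<longlonglongrightarrow> 0)"

definition boundary_mean :: "'a::euclidean_space set \<Rightarrow> ('a \<Rightarrow> real) \<Rightarrow> real" where
  "boundary_mean \<Gamma> g =
     (\<integral>x. g x \<partial>surface_measure \<Gamma>) / measure (surface_measure \<Gamma>) \<Gamma>"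

definition H1_mean_zero :: "'a::euclidean_space set \<Rightarrow> 'a set \<Rightarrow> ('a \<Rightarrow> real) set" where
  "H1_mean_zero \<Omega> \<Gamma> = {w \<in> H1 \<Omega>. \<exists>g. has_trace \<Omega> w g \<and> boundary_mean \<Gamma> g = 0}"

definition poincare_bound :: "'a::euclidean_space set \<Rightarrow> 'a set \<Rightarrow> real \<Rightarrow> bool" where
  "poincare_bound \<Omega> \<Gamma> C \<longleftrightarrow>
     (\<forall>w \<in> H1_mean_zero \<Omega> \<Gamma>.
        L2_norm (lebesgue_on \<Omega>) w \<le> C * L2_norm (lebesgue_on \<Omega>) (weak_gradient \<Omega> w))"

text \<open>
  \<open>is_sharp_constant \<Omega> \<Gamma> C\<close> says that \<open>C\<^sub>1(\<Omega>, \<Gamma>)\<close> exists and equals \<open>C\<close>; a smallest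
  admissible constant is unique.
\<close>

definition is_sharp_constant :: "'a::euclidean_space set \<Rightarrow> 'a set \<Rightarrow> real \<Rightarrow> bool" where
  "is_sharp_constant \<Omega> \<Gamma> C \<longleftrightarrow>
     poincare_bound \<Omega> \<Gamma> C \<and> (\<forall>C'. poincare_bound \<Omega> \<Gamma> C' \<longrightarrow> C \<le> C')"

end

theory Submission
  imports Defs "HOL-Computational_Algebra.Polynomial"
begin

text \<open>
  The upper bound rests on one inequality on intervals: if \<open>v\<close> is \<open>C\<^sup>1\<close> on an interval of length
  \<open>h\<close> and \<open>P\<close> is the mean of its two end values, then \<open>(\<pi>/h)\<^sup>2 \<integral>(v - P)\<^sup>2 \<le> \<integral>v'\<^sup>2\<close>
  (\<open>wirtinger_endpoint_average\<close>). Indeed \<open>v - P\<close> takes opposite values at the ends, so it extends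
  to an antiperiodic function, whose lowest frequency is \<open>\<pi>/h\<close>.

  Let \<open>u\<close> be smooth on the closed rectangle. On each horizontal line let \<open>P(y)\<close> be the mean of the
  values of \<open>u\<close> on the left and right edges, and on each vertical line let \<open>R(x)\<close> be the mean of its
  values on the bottom and top edges. With \<open>k = \<pi>/max h\<^sub>1 h\<^sub>2\<close>, the inequality on all lines gives
  \<open>k\<^sup>2 \<integral>((u - P)\<^sup>2 + (u - R)\<^sup>2) \<le> \<integral>|\<nabla>u|\<^sup>2\<close>. Since
  \<open>(u - P)\<^sup>2 + (u - R)\<^sup>2 = u\<^sup>2 + (u - P - R)\<^sup>2 - 2PR\<close> and \<open>PR\<close> is a product of functions of one
  variable each, the left side is at least \<open>k\<^sup>2 (\<integral>u\<^sup>2 - 2 (\<integral>P)(\<integral>R))\<close>. The boundary integral of \<open>u\<close> is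
  \<open>I = 2 \<integral>P + 2 \<integral>R\<close>; when it vanishes, \<open>(\<integral>P)(\<integral>R)\<close> is minus a square, and in general it is at
  most \<open>I\<^sup>2/16\<close>. Hence \<open>k\<^sup>2 \<integral>u\<^sup>2 \<le> \<integral>|\<nabla>u|\<^sup>2 + k\<^sup>2 I\<^sup>2/8\<close> (\<open>poincare_rectangle_classical\<close>). The error term
  is what permits passing to the limit: smooth functions that converge in \<open>H\<^sup>1\<close> and whose boundary
  values converge in \<open>L\<^sup>2\<close> to a trace of mean zero have \<open>I \<longlonglongrightarrow> 0\<close> (\<open>poincare_bound_rectangle\<close>).

  Two identifications connect this computation with the definitions. The one-dimensional Hausdorff
  measure makes Borel sets measurable and is length on line segments, so boundary integrals of
  continuous functions are sums of four edge integrals (\<open>has_boundary_integral_rectangle\<close>). The weak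
  gradient is determined almost everywhere, because a function orthogonal to all test functions
  vanishes (\<open>weak_gradient_unique\<close>), and for smooth functions it is the classical gradient
  (\<open>has_weak_gradient_smooth\<close>).

  The constant is attained by \<open>sin (\<pi>x/h\<^sub>1)\<close> or \<open>sin (\<pi>y/h\<^sub>2)\<close>, whichever belongs to the longer
  side; both have boundary mean zero by antisymmetry (\<open>poincare_bound_lower\<close>).
\<close>


section \<open>The sharp inequality for smooth functions on a rectangle\<close>

text \<open>
  At a pole of the cotangent the quotient of \<open>v\<close> by the sine stays bounded because \<open>v\<close> vanishes
  there, and the second factor \<open>v\<close> forces the limit \<open>0\<close>. This agrees with the value given by
  \<open>cot x = cos x / sin x\<close> and division by zero.
\<close>
lemma isCont_square_times_cot:
  fixes v :: "real \<Rightarrow> real"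
  assumes der: "\<And>x. (v has_real_derivative v' x) (at x)"
    and zero: "sin (k * (x - t)) = 0 \<Longrightarrow> v x = 0" and "k \<noteq> 0"
  shows "isCont (\<lambda>x. k * (v x)\<^sup>2 * cot (k * (x - t))) x"
proof -
  have cv: "isCont v x" using der DERIV_isCont by blast
  show ?thesis
  proof (cases "sin (k * (x - t)) = 0")
    case False
    then show ?thesis using cv by (intro continuous_intros) (auto)
  next
    case True
    then have v0: "v x = 0" by (rule zero)
    define s where "s = (\<lambda>y. sin (k * (y - t)))"
    have s0: "s x = 0" using True by (simp add: s_def)
    have cs: "cos (k * (x - t)) \<noteq> 0" using True by (metis sin_zero_norm_cos_one norm_zero zero_neq_one)
    have "(s has_real_derivative k * cos (k * (x - t))) (at x)"
      unfolding s_def by (auto intro!: derivative_eq_intros)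
    then have 1: "((\<lambda>y. (s y - s x) / (y - x)) \<longlongrightarrow> k * cos (k * (x - t))) (at x)"
      by (simp add: has_field_derivative_iff)
    have 2: "((\<lambda>y. (v y - v x) / (y - x)) \<longlongrightarrow> v' x) (at x)"
      using der[of x] by (simp add: has_field_derivative_iff)
    have "((\<lambda>y. ((v y - v x) / (y - x)) / ((s y - s x) / (y - x))) \<longlongrightarrow> v' x / (k * cos (k * (x - t)))) (at x)"
      by (intro tendsto_divide 1 2) (use cs \<open>k \<noteq> 0\<close> in auto)
    then have 3: "((\<lambda>y. v y / s y) \<longlongrightarrow> v' x / (k * cos (k * (x - t)))) (at x)"
    proof (rule Lim_transform_eventually)
      show "\<forall>\<^sub>F y in at x. ((v y - v x) / (y - x)) / ((s y - s x) / (y - x)) = v y / s y"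
        by (rule eventually_at_topological[THEN iffD2], rule exI[of _ UNIV]) (auto simp: v0 s0)
    qed
    have 4: "((\<lambda>y. k * v y * cos (k * (y - t))) \<longlongrightarrow> k * v x * cos (k * (x - t))) (at x)"
      using cv unfolding isCont_def by (intro tendsto_intros) auto
    have "((\<lambda>y. (k * v y * cos (k * (y - t))) * (v y / s y)) \<longlongrightarrow> 0) (at x)"
      using tendsto_mult[OF 4 3] by (simp add: v0)
    then show ?thesis
      unfolding isCont_def by (simp add: v0 cot_def s_def power2_eq_square mult_ac)
  qed
qed

text \<open>
  Completing the square: with \<open>W = k v\<^sup>2 cot (k (x - t))\<close> one has
  \<open>v'\<^sup>2 - k\<^sup>2 v\<^sup>2 - W' = (v' - k v cot (k (x - t)))\<^sup>2 \<ge> 0\<close>, so it is enough that \<open>W\<close> takes equal values at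
  the two ends. It does when \<open>k = \<pi> / (\<beta> - \<alpha>)\<close>, since the cotangent has period \<open>\<pi>\<close> and the squares of
  the end values of \<open>v\<close> agree. Choosing \<open>t\<close> as a zero of \<open>v\<close>, which exists by the sign change, makes the
  pole of the cotangent harmless.
\<close>
lemma wirtinger_antiperiodic:
  fixes v :: "real \<Rightarrow> real"
  assumes "\<alpha> < \<beta>"
    and der: "\<And>x. (v has_real_derivative v' x) (at x)"
    and cont: "continuous_on {\<alpha>..\<beta>} v'"
    and anti: "v \<alpha> + v \<beta> = 0"
  shows "(pi / (\<beta> - \<alpha>))\<^sup>2 * integral {\<alpha>..\<beta>} (\<lambda>x. (v x)\<^sup>2) \<le> integral {\<alpha>..\<beta>} (\<lambda>x. (v' x)\<^sup>2)"
proof -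
  define k where "k = pi / (\<beta> - \<alpha>)"
  have k: "k > 0" "k * (\<beta> - \<alpha>) = pi" using assms(1) by (auto simp: k_def)
  have cv: "continuous_on {\<alpha>..\<beta>} v"
    by (meson DERIV_continuous_on has_field_derivative_at_within der)
  obtain t where t: "t \<in> {\<alpha>..\<beta>}" "v t = 0"
  proof (cases "v \<alpha> \<le> 0")
    case True
    then show ?thesis using IVT'[of v \<alpha> 0 \<beta>] cv assms(1) anti that by auto
  next
    case False
    then show ?thesis using IVT2'[of v \<beta> 0 \<alpha>] cv assms(1) anti that by auto
  qed
  define W where "W = (\<lambda>x. k * (v x)\<^sup>2 * cot (k * (x - t)))"
  define S where "S = {x \<in> {\<alpha>..\<beta>}. sin (k * (x - t)) = 0}"
  \<comment> \<open>The only pole is \<open>t\<close>, except that both end points are poles if \<open>t\<close> is one of them.\<close>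
  have S: "x \<in> {t, \<alpha>, \<beta>} \<and> v x = 0" if "x \<in> S" for x
  proof -
    have x: "\<alpha> \<le> x" "x \<le> \<beta>" "sin (k * (x - t)) = 0" using that by (auto simp: S_def)
    then obtain n :: int where "k * (x - t) = of_int n * pi" by (auto simp: sin_zero_iff_int2)
    then have "k * (x - t) = k * (of_int n * (\<beta> - \<alpha>))" unfolding k(2)[symmetric] by (simp only: mult.left_commute)
    then have n: "x - t = of_int n * (\<beta> - \<alpha>)" using k(1) by simp
    have "\<bar>x - t\<bar> \<le> \<beta> - \<alpha>" using x t by auto
    then have "\<bar>of_int n :: real\<bar> * (\<beta> - \<alpha>) \<le> 1 * (\<beta> - \<alpha>)" using n assms(1) by (simp add: abs_mult)
    then have "\<bar>of_int n :: real\<bar> \<le> 1" using assms(1) by (meson diff_gt_0_iff_gt mult_le_cancel_right_pos)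
    then have "n = 0 \<or> n = 1 \<or> n = -1" by linarith
    then consider "x = t" | "x = \<beta>" "t = \<alpha>" | "x = \<alpha>" "t = \<beta>" using n x t by fastforce
    then show ?thesis using t anti by cases auto
  qed
  have finS: "finite S" by (rule finite_subset[of _ "{t, \<alpha>, \<beta>}"]) (use S in auto)
  have cW: "continuous_on {\<alpha>..\<beta>} W"
    unfolding W_def
    by (intro continuous_at_imp_continuous_on ballI isCont_square_times_cot[OF der])
       (use S k in \<open>auto simp: S_def\<close>)
  define W' where "W' = (\<lambda>x. 2 * k * v x * v' x * cot (k * (x - t)) - k\<^sup>2 * (v x)\<^sup>2 / (sin (k * (x - t)))\<^sup>2)"
  have dW: "(W has_vector_derivative W' x) (at x)" if "x \<in> {\<alpha><..<\<beta>} - S" for x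
  proof -
    have "sin (k * (x - t)) \<noteq> 0" using that by (auto simp: S_def)
    then have "((\<lambda>x. cot (k * (x - t))) has_real_derivative - inverse ((sin (k * (x - t)))\<^sup>2) * k) (at x)"
      by (intro DERIV_chain2[where f=cot] DERIV_cot) (auto intro!: derivative_eq_intros)
    from DERIV_mult[OF DERIV_cmult[OF DERIV_power[OF der[of x], of 2], of k] this]
    have "(W has_real_derivative W' x) (at x)"
      unfolding W_def W'_def by (simp add: power2_eq_square divide_inverse mult_ac)
    then show ?thesis by (simp add: has_real_derivative_iff_has_vector_derivative)
  qed
  have Wint: "(W' has_integral (W \<beta> - W \<alpha>)) {\<alpha>..\<beta>}"
    by (rule fundamental_theorem_of_calculus_interior_strong[OF finS _ dW cW]) (use assms(1) in auto)
  have Wend: "W \<beta> = W \<alpha>"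
  proof -
    have "k * (\<beta> - t) = k * (\<alpha> - t) + pi" using k(2) by (simp add: algebra_simps)
    moreover have "(v \<beta>)\<^sup>2 = (v \<alpha>)\<^sup>2" using anti by (simp add: eq_neg_iff_add_eq_0[symmetric])
    ultimately show ?thesis by (simp add: W_def cot_def)
  qed
  have le: "W' x \<le> (v' x)\<^sup>2 - k\<^sup>2 * (v x)\<^sup>2" if "x \<in> {\<alpha>..\<beta>} - S" for x
  proof -
    have s: "sin (k * (x - t)) \<noteq> 0" using that by (auto simp: S_def)
    have "1 / (sin (k * (x - t)))\<^sup>2 = 1 + (cot (k * (x - t)))\<^sup>2"
      using s by (simp add: cot_def divide_simps power2_eq_square[symmetric])
    then have "k\<^sup>2 * (v x)\<^sup>2 / (sin (k * (x - t)))\<^sup>2 = k\<^sup>2 * (v x)\<^sup>2 * (1 + (cot (k * (x - t)))\<^sup>2)"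
      by (metis times_divide_eq_right mult.right_neutral)
    then have "(v' x)\<^sup>2 - k\<^sup>2 * (v x)\<^sup>2 - W' x = (v' x - k * v x * cot (k * (x - t)))\<^sup>2"
      by (simp add: W'_def power2_eq_square algebra_simps)
    then show ?thesis by (metis diff_ge_0_iff_ge zero_le_power2)
  qed
  have i1: "(\<lambda>x. (v' x)\<^sup>2) integrable_on {\<alpha>..\<beta>}" "(\<lambda>x. (v x)\<^sup>2) integrable_on {\<alpha>..\<beta>}"
    by (intro integrable_continuous_real continuous_intros cont cv)+
  then have i2: "((\<lambda>x. (v' x)\<^sup>2 - k\<^sup>2 * (v x)\<^sup>2) has_integral
      (integral {\<alpha>..\<beta>} (\<lambda>x. (v' x)\<^sup>2) - k\<^sup>2 * integral {\<alpha>..\<beta>} (\<lambda>x. (v x)\<^sup>2))) {\<alpha>..\<beta>}"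
    by (intro has_integral_diff has_integral_mult_right integrable_integral)
  \<comment> \<open>The inequality holds off the finite set \<open>S\<close> only, so the integrand is redefined there.\<close>
  have "((\<lambda>x. if x \<in> S then (v' x)\<^sup>2 - k\<^sup>2 * (v x)\<^sup>2 else W' x) has_integral (W \<beta> - W \<alpha>)) {\<alpha>..\<beta>}"
    by (rule has_integral_spike_finite[OF finS _ Wint]) auto
  from has_integral_le[OF this i2] le Wend
  have "0 \<le> integral {\<alpha>..\<beta>} (\<lambda>x. (v' x)\<^sup>2) - k\<^sup>2 * integral {\<alpha>..\<beta>} (\<lambda>x. (v x)\<^sup>2)" by auto
  then show ?thesis by (simp add: k_def)
qed

lemma wirtinger_endpoint_average:
  fixes v :: "real \<Rightarrow> real"
  assumes "\<alpha> < \<beta>"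
    and der: "\<And>x. (v has_real_derivative v' x) (at x)"
    and cont: "continuous_on {\<alpha>..\<beta>} v'"
  shows "(pi / (\<beta> - \<alpha>))\<^sup>2 * integral {\<alpha>..\<beta>} (\<lambda>x. (v x - (v \<alpha> + v \<beta>) / 2)\<^sup>2)
    \<le> integral {\<alpha>..\<beta>} (\<lambda>x. (v' x)\<^sup>2)"
  by (rule wirtinger_antiperiodic[OF assms(1) _ cont])
     (auto intro!: derivative_eq_intros der simp: field_simps)

lemma integral_cbox_iterated:
  fixes f :: "real \<times> real \<Rightarrow> real"
  assumes "continuous_on (cbox (a,c) (b,d)) f"
  shows "integral (cbox (a,c) (b,d)) f = integral {a..b} (\<lambda>x. integral {c..d} (\<lambda>y. f (x,y)))"
    and "integral (cbox (a,c) (b,d)) f = integral {c..d} (\<lambda>y. integral {a..b} (\<lambda>x. f (x,y)))"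
    and "(\<lambda>x. integral {c..d} (\<lambda>y. f (x,y))) integrable_on {a..b}"
    and "(\<lambda>y. integral {a..b} (\<lambda>x. f (x,y))) integrable_on {c..d}"
proof -
  show 1: "integral (cbox (a,c) (b,d)) f = integral {a..b} (\<lambda>x. integral {c..d} (\<lambda>y. f (x,y)))"
    using integral_prod_continuous[OF assms] by simp
  show "integral (cbox (a,c) (b,d)) f = integral {c..d} (\<lambda>y. integral {a..b} (\<lambda>x. f (x,y)))"
    using 1 integral_swap_continuous[of a c b d "\<lambda>x y. f (x,y)"] assms by (simp add: case_prod_beta)
  show "(\<lambda>x. integral {c..d} (\<lambda>y. f (x,y))) integrable_on {a..b}"
    using integral_integrable_2dim[OF assms] by simp
  have "continuous_on (cbox (c,a) (d,b)) (\<lambda>p. f (prod.swap p))"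
    by (rule continuous_on_compose2[OF assms]) (auto intro!: continuous_intros simp: cbox_Pair_eq prod.swap_def)
  from integral_integrable_2dim[OF this]
  show "(\<lambda>y. integral {a..b} (\<lambda>x. f (x,y))) integrable_on {c..d}" by simp
qed

definition edge_integral :: "real \<Rightarrow> real \<Rightarrow> (real \<times> real \<Rightarrow> real) \<Rightarrow> real" where
  "edge_integral a b u =
     integral {-b..b} (\<lambda>y. u (a, y) + u (-a, y)) + integral {-a..a} (\<lambda>x. u (x, b) + u (x, -b))"

text \<open>
  The cross term \<open>2PR\<close> is the only obstruction to summing the inequalities on horizontal and on
  vertical lines, and its integral is controlled by the boundary integral:
  \<open>I\<^sup>2/8 - 2pr = (p - r)\<^sup>2/2\<close> for \<open>I = 2p + 2r\<close>.
\<close>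
lemma poincare_rectangle_classical:
  fixes u :: "real \<times> real \<Rightarrow> real"
  assumes ab: "a > 0" "b > 0" and k: "0 \<le> k" "k * (2 * a) \<le> pi" "k * (2 * b) \<le> pi"
    and d1: "\<And>x y. ((\<lambda>x. u (x, y)) has_real_derivative u1 (x, y)) (at x)"
    and d2: "\<And>x y. ((\<lambda>y. u (x, y)) has_real_derivative u2 (x, y)) (at y)"
    and cu: "continuous_on UNIV u" and c1: "continuous_on UNIV u1" and c2: "continuous_on UNIV u2"
  shows "k\<^sup>2 * integral (cbox (-a,-b) (a,b)) (\<lambda>z. (u z)\<^sup>2)
    \<le> integral (cbox (-a,-b) (a,b)) (\<lambda>z. (u1 z)\<^sup>2 + (u2 z)\<^sup>2) + k\<^sup>2 * (edge_integral a b u)\<^sup>2 / 8"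
proof -
  let ?B = "cbox (-a,-b) (a,b)"
  define P where "P = (\<lambda>y. (u (-a, y) + u (a, y)) / 2)"
  define R where "R = (\<lambda>x. (u (x, -b) + u (x, b)) / 2)"
  have cont [continuous_intros]:
    "continuous_on S (\<lambda>z. u (f z))" "continuous_on S (\<lambda>z. u1 (f z))" "continuous_on S (\<lambda>z. u2 (f z))"
    if "continuous_on S f" for S and f :: "'x::topological_space \<Rightarrow> real \<times> real"
    using that by (auto intro: continuous_on_compose2[OF cu] continuous_on_compose2[OF c1] continuous_on_compose2[OF c2])
  have cP [continuous_intros]: "continuous_on S (\<lambda>z. P (f z))" and cR [continuous_intros]: "continuous_on S (\<lambda>z. R (f z))"
    if "continuous_on S f" for S and f :: "'x::topological_space \<Rightarrow> real"
    unfolding P_def R_def by (auto intro!: continuous_intros that)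
  have ksq: "k\<^sup>2 \<le> (pi / (2 * l))\<^sup>2" if "l > 0" "k * (2 * l) \<le> pi" for l
    using that k(1) by (intro power_mono) (auto simp: field_simps)
  have "k\<^sup>2 * integral ?B (\<lambda>z. (u z - P (snd z))\<^sup>2) = integral {-b..b} (\<lambda>y. k\<^sup>2 * integral {-a..a} (\<lambda>x. (u (x,y) - P y)\<^sup>2))"
    by (subst integral_cbox_iterated(2)) (auto intro!: continuous_intros)
  also have "\<dots> \<le> integral {-b..b} (\<lambda>y. integral {-a..a} (\<lambda>x. (u1 (x,y))\<^sup>2))"
  proof (rule integral_le)
    show "(\<lambda>y. k\<^sup>2 * integral {-a..a} (\<lambda>x. (u (x,y) - P y)\<^sup>2)) integrable_on {-b..b}"
      by (intro integrable_on_mult_right continuous_intros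
          integral_cbox_iterated(4)[of "-a" "-b" a b "\<lambda>z. (u z - P (snd z))\<^sup>2", unfolded snd_conv])
    show "(\<lambda>y. integral {-a..a} (\<lambda>x. (u1 (x,y))\<^sup>2)) integrable_on {-b..b}"
      by (rule integral_cbox_iterated(4)) (auto intro!: continuous_intros)
    fix y
    have "k\<^sup>2 * integral {-a..a} (\<lambda>x. (u (x,y) - P y)\<^sup>2) \<le> (pi / (2 * a))\<^sup>2 * integral {-a..a} (\<lambda>x. (u (x,y) - P y)\<^sup>2)"
      by (intro mult_right_mono ksq ab k integral_nonneg integrable_continuous_real continuous_intros) auto
    also have "\<dots> \<le> integral {-a..a} (\<lambda>x. (u1 (x,y))\<^sup>2)"
      using wirtinger_endpoint_average[of "-a" a "\<lambda>x. u (x,y)" "\<lambda>x. u1 (x,y)", OF _ d1] ab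
      by (simp add: P_def continuous_intros)
    finally show "k\<^sup>2 * integral {-a..a} (\<lambda>x. (u (x,y) - P y)\<^sup>2) \<le> integral {-a..a} (\<lambda>x. (u1 (x,y))\<^sup>2)" .
  qed
  also have "\<dots> = integral ?B (\<lambda>z. (u1 z)\<^sup>2)"
    by (subst integral_cbox_iterated(2)) (auto intro!: continuous_intros)
  finally have 1: "k\<^sup>2 * integral ?B (\<lambda>z. (u z - P (snd z))\<^sup>2) \<le> integral ?B (\<lambda>z. (u1 z)\<^sup>2)" .
  have "k\<^sup>2 * integral ?B (\<lambda>z. (u z - R (fst z))\<^sup>2) = integral {-a..a} (\<lambda>x. k\<^sup>2 * integral {-b..b} (\<lambda>y. (u (x,y) - R x)\<^sup>2))"
    by (subst integral_cbox_iterated(1)) (auto intro!: continuous_intros)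
  also have "\<dots> \<le> integral {-a..a} (\<lambda>x. integral {-b..b} (\<lambda>y. (u2 (x,y))\<^sup>2))"
  proof (rule integral_le)
    show "(\<lambda>x. k\<^sup>2 * integral {-b..b} (\<lambda>y. (u (x,y) - R x)\<^sup>2)) integrable_on {-a..a}"
      by (intro integrable_on_mult_right continuous_intros
          integral_cbox_iterated(3)[of "-a" "-b" a b "\<lambda>z. (u z - R (fst z))\<^sup>2", unfolded fst_conv])
    show "(\<lambda>x. integral {-b..b} (\<lambda>y. (u2 (x,y))\<^sup>2)) integrable_on {-a..a}"
      by (rule integral_cbox_iterated(3)) (auto intro!: continuous_intros)
    fix x
    have "k\<^sup>2 * integral {-b..b} (\<lambda>y. (u (x,y) - R x)\<^sup>2) \<le> (pi / (2 * b))\<^sup>2 * integral {-b..b} (\<lambda>y. (u (x,y) - R x)\<^sup>2)"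
      by (intro mult_right_mono ksq ab k integral_nonneg integrable_continuous_real continuous_intros) auto
    also have "\<dots> \<le> integral {-b..b} (\<lambda>y. (u2 (x,y))\<^sup>2)"
      using wirtinger_endpoint_average[of "-b" b "\<lambda>y. u (x,y)" "\<lambda>y. u2 (x,y)", OF _ d2] ab
      by (simp add: R_def continuous_intros)
    finally show "k\<^sup>2 * integral {-b..b} (\<lambda>y. (u (x,y) - R x)\<^sup>2) \<le> integral {-b..b} (\<lambda>y. (u2 (x,y))\<^sup>2)" .
  qed
  also have "\<dots> = integral ?B (\<lambda>z. (u2 z)\<^sup>2)"
    by (subst integral_cbox_iterated(1)) (auto intro!: continuous_intros)
  finally have 2: "k\<^sup>2 * integral ?B (\<lambda>z. (u z - R (fst z))\<^sup>2) \<le> integral ?B (\<lambda>z. (u2 z)\<^sup>2)" .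
  define p r where "p = integral {-b..b} P" and "r = integral {-a..a} R"
  have "integral ?B (\<lambda>z. R (fst z) * P (snd z)) = integral {-a..a} (\<lambda>x. R x * p)"
    by (subst integral_cbox_iterated(1)) (auto intro!: continuous_intros simp: p_def)
  then have 3: "integral ?B (\<lambda>z. R (fst z) * P (snd z)) = p * r"
    by (simp add: r_def)
  have "integral ?B (\<lambda>z. (u z)\<^sup>2 - 2 * (R (fst z) * P (snd z)))
    \<le> integral ?B (\<lambda>z. (u z - P (snd z))\<^sup>2 + (u z - R (fst z))\<^sup>2)"
  proof (intro integral_le integrable_continuous continuous_intros)
    fix z
    have "(u z - P (snd z))\<^sup>2 + (u z - R (fst z))\<^sup>2 - ((u z)\<^sup>2 - 2 * (R (fst z) * P (snd z)))
      = (u z - P (snd z) - R (fst z))\<^sup>2"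
      by (simp add: power2_eq_square algebra_simps)
    then show "(u z)\<^sup>2 - 2 * (R (fst z) * P (snd z)) \<le> (u z - P (snd z))\<^sup>2 + (u z - R (fst z))\<^sup>2"
      by (metis diff_ge_0_iff_ge zero_le_power2)
  qed
  also have "integral ?B (\<lambda>z. (u z)\<^sup>2 - 2 * (R (fst z) * P (snd z))) = integral ?B (\<lambda>z. (u z)\<^sup>2) - 2 * (p * r)"
    unfolding 3[symmetric] integral_mult_right[symmetric]
    by (intro integral_diff integrable_continuous continuous_intros)
  also have "integral ?B (\<lambda>z. (u z - P (snd z))\<^sup>2 + (u z - R (fst z))\<^sup>2)
    = integral ?B (\<lambda>z. (u z - P (snd z))\<^sup>2) + integral ?B (\<lambda>z. (u z - R (fst z))\<^sup>2)"
    by (intro integral_add integrable_continuous continuous_intros)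
  finally have 4: "integral ?B (\<lambda>z. (u z)\<^sup>2)
    \<le> integral ?B (\<lambda>z. (u z - P (snd z))\<^sup>2) + integral ?B (\<lambda>z. (u z - R (fst z))\<^sup>2) + 2 * (p * r)" by simp
  have "edge_integral a b u = 2 * p + 2 * r"
    by (simp add: edge_integral_def p_def r_def P_def R_def add.commute)
  then have "(edge_integral a b u)\<^sup>2 / 8 - 2 * (p * r) = (p - r)\<^sup>2 / 2"
    by (simp add: power2_eq_square algebra_simps)
  then have 5: "2 * (p * r) \<le> (edge_integral a b u)\<^sup>2 / 8"
    by (metis diff_ge_0_iff_ge zero_le_power2 divide_nonneg_nonneg zero_le_numeral)
  have "integral ?B (\<lambda>z. (u1 z)\<^sup>2 + (u2 z)\<^sup>2) = integral ?B (\<lambda>z. (u1 z)\<^sup>2) + integral ?B (\<lambda>z. (u2 z)\<^sup>2)"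
    by (intro integral_add integrable_continuous continuous_intros)
  moreover have "k\<^sup>2 * integral ?B (\<lambda>z. (u z)\<^sup>2) \<le> k\<^sup>2 * (integral ?B (\<lambda>z. (u z - P (snd z))\<^sup>2) + integral ?B (\<lambda>z. (u z - R (fst z))\<^sup>2) + (edge_integral a b u)\<^sup>2 / 8)"
    using 4 5 by (intro mult_left_mono) auto
  ultimately show ?thesis using 1 2 by (simp add: distrib_left)
qed

section \<open>Borel sets are measurable for the Hausdorff measure\<close>

lemma hausdorff_cost_mono:
  assumes "U \<subseteq> V" "bounded V"
  shows "hausdorff_cost s U \<le> hausdorff_cost s V"
proof -
  have "bounded U" using assms bounded_subset by blast
  then have "(diameter U / 2) ^ s \<le> (diameter V / 2) ^ s"
    using diameter_subset[OF assms] diameter_ge_0 by (intro power_mono) auto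
  then have "unit_ball_vol (real s) * (diameter U / 2) ^ s \<le> unit_ball_vol (real s) * (diameter V / 2) ^ s"
    by (intro mult_left_mono) auto
  then show ?thesis using assms by (auto simp: hausdorff_cost_def ennreal_leI)
qed

lemma hausdorff_content_antimono:
  "\<delta> \<le> \<delta>' \<Longrightarrow> hausdorff_content s \<delta>' A \<le> hausdorff_content s \<delta> A"
  unfolding hausdorff_content_def by (intro INF_superset_mono) (auto intro: order_trans)

lemma hausdorff_outer_empty: "hausdorff_outer s ({} :: 'a::metric_space set) = 0"
  using outer_measure_space_hausdorff_outer[of s, where 'a='a] by (simp add: outer_measure_space_def positive_def)

lemma hausdorff_outer_mono:
  fixes A B :: "'a::metric_space set"
  shows "A \<subseteq> B \<Longrightarrow> hausdorff_outer s A \<le> hausdorff_outer s B"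
  using outer_measure_space_hausdorff_outer[of s, where 'a='a] by (simp add: outer_measure_space_def increasing_def)

lemma hausdorff_outer_UN: "hausdorff_outer s (\<Union>i. A i) \<le> (\<Sum>i. hausdorff_outer s (A i))"
  unfolding hausdorff_outer_def[of s "\<Union>i. A i"]
proof (rule SUP_least)
  fix \<delta> :: real assume \<delta>: "\<delta> \<in> {0<..}"
  have "hausdorff_content s \<delta> (\<Union>i. A i) \<le> (\<Sum>i. hausdorff_content s \<delta> (A i))"
    using hausdorff_content_subadditive \<delta> by auto
  also have "\<dots> \<le> (\<Sum>i. hausdorff_outer s (A i))"
    unfolding hausdorff_outer_def by (intro suminf_le SUP_upper \<delta>) auto
  finally show "hausdorff_content s \<delta> (\<Union>i. A i) \<le> (\<Sum>i. hausdorff_outer s (A i))" .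
qed

lemma hausdorff_outer_Un: "hausdorff_outer s (A \<union> B) \<le> hausdorff_outer s A + hausdorff_outer s B"
  using hausdorff_outer_UN[of s "binaryset A B"]
  by (simp add: UN_binaryset_eq suminf_binaryset_eq hausdorff_outer_empty)

text \<open>
  A set of diameter at most \<open>\<delta>\<close> cannot meet both \<open>A\<close> and \<open>B\<close>, so a cover of the union splits into a cover
  of \<open>A\<close> and one of \<open>B\<close>.
\<close>
lemma hausdorff_content_separated:
  assumes sep: "\<And>x y. x \<in> A \<Longrightarrow> y \<in> B \<Longrightarrow> \<delta> < dist x y"
  shows "hausdorff_content s \<delta> A + hausdorff_content s \<delta> B \<le> hausdorff_content s \<delta> (A \<union> B)"
  unfolding hausdorff_content_def[of s \<delta> "A \<union> B"]
proof (rule INF_greatest)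
  fix U :: "nat \<Rightarrow> 'a set"
  assume "U \<in> {U. A \<union> B \<subseteq> \<Union> (range U) \<and> (\<forall>i. bounded (U i) \<and> diameter (U i) \<le> \<delta>)}"
  then have cov: "A \<union> B \<subseteq> (\<Union>i. U i)" and U: "\<And>i. bounded (U i)" "\<And>i. diameter (U i) \<le> \<delta>" by auto
  have le: "hausdorff_content s \<delta> S \<le> (\<Sum>i. hausdorff_cost s (U i \<inter> S))" if "S \<subseteq> A \<union> B" for S
    unfolding hausdorff_content_def
  proof (rule INF_lower)
    have "bounded (U i \<inter> S) \<and> diameter (U i \<inter> S) \<le> \<delta>" for i
      using U(1)[of i] U(2)[of i] diameter_subset[of "U i \<inter> S" "U i"] by (auto intro: bounded_subset)
    then show "(\<lambda>i. U i \<inter> S) \<in> {U. S \<subseteq> \<Union> (range U) \<and> (\<forall>i. bounded (U i) \<and> diameter (U i) \<le> \<delta>)}"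
      using cov that by blast
  qed
  have "hausdorff_cost s (U i \<inter> A) + hausdorff_cost s (U i \<inter> B) \<le> hausdorff_cost s (U i)" for i
  proof -
    have "U i \<inter> A = {} \<or> U i \<inter> B = {}"
    proof (rule ccontr)
      assume "\<not> ?thesis"
      then obtain x y where xy: "x \<in> U i" "x \<in> A" "y \<in> U i" "y \<in> B" by blast
      then have "dist x y \<le> \<delta>" using diameter_bounded_bound[OF U(1)] U(2) order_trans by blast
      with sep xy show False by fastforce
    qed
    moreover have "hausdorff_cost s (U i \<inter> S) \<le> hausdorff_cost s (U i)" for S
      by (rule hausdorff_cost_mono[OF _ U(1)]) auto
    moreover have "hausdorff_cost s ({} :: 'a set) = 0" by (simp add: hausdorff_cost_def)
    ultimately show ?thesis by (metis add.left_neutral add.right_neutral)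
  qed
  then have "(\<Sum>i. hausdorff_cost s (U i \<inter> A) + hausdorff_cost s (U i \<inter> B)) \<le> (\<Sum>i. hausdorff_cost s (U i))"
    by (intro suminf_le) auto
  then show "hausdorff_content s \<delta> A + hausdorff_content s \<delta> B \<le> (\<Sum>i. hausdorff_cost s (U i))"
    using le[of A] le[of B] by (auto simp: suminf_add[symmetric] intro: order_trans add_mono)
qed

lemma hausdorff_outer_separated:
  assumes "d > 0" and sep: "\<And>x y. x \<in> A \<Longrightarrow> y \<in> B \<Longrightarrow> d \<le> dist x y"
  shows "hausdorff_outer s A + hausdorff_outer s B \<le> hausdorff_outer s (A \<union> B)"
proof -
  have le: "hausdorff_content s \<delta>1 A + hausdorff_content s \<delta>2 B \<le> hausdorff_outer s (A \<union> B)"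
    if "\<delta>1 \<in> {0<..}" "\<delta>2 \<in> {0<..}" for \<delta>1 \<delta>2
  proof -
    define \<delta> where "\<delta> = min (d / 2) (min \<delta>1 \<delta>2)"
    have \<delta>: "\<delta> > 0" "\<delta> < d" "\<delta> \<le> \<delta>1" "\<delta> \<le> \<delta>2" using that assms by (auto simp: \<delta>_def)
    have "hausdorff_content s \<delta>1 A + hausdorff_content s \<delta>2 B \<le> hausdorff_content s \<delta> A + hausdorff_content s \<delta> B"
      by (intro add_mono hausdorff_content_antimono \<delta>)
    also have "\<dots> \<le> hausdorff_content s \<delta> (A \<union> B)"
      by (rule hausdorff_content_separated) (use sep \<delta> in fastforce)
    also have "\<dots> \<le> hausdorff_outer s (A \<union> B)"
      unfolding hausdorff_outer_def by (rule SUP_upper) (use \<delta> in auto)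
    finally show ?thesis .
  qed
  have ne: "{0::real<..} \<noteq> {}" by (simp add: not_empty_eq_Ici_eq_empty)
  have "hausdorff_content s \<delta>1 A + hausdorff_outer s B \<le> hausdorff_outer s (A \<union> B)" if "\<delta>1 \<in> {0<..}" for \<delta>1
    unfolding hausdorff_outer_def[of s B] add.commute[of "hausdorff_content s \<delta>1 A"]
    by (subst ennreal_SUP_add_left[symmetric, OF ne], rule SUP_least, subst add.commute, rule le[OF that])
  then show ?thesis
    unfolding hausdorff_outer_def[of s A]
    by (subst ennreal_SUP_add_left[symmetric, OF ne], intro SUP_least)
qed

text \<open>
  Caratheodory's criterion for metric outer measures. The part \<open>B m\<close> of \<open>A\<close> at distance at least \<open>1/(m+1)\<close>
  from \<open>F\<close> is separated from \<open>F\<close>, so additivity holds with \<open>B m\<close> in place of \<open>A - F\<close>. What is missing is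
  covered by the rings \<open>R i\<close> with \<open>i \<ge> m\<close>, and their total measure is the tail of a convergent series.
\<close>
lemma closed_in_sets_hausdorff_measure:
  fixes F :: "'a::metric_space set"
  assumes "closed F"
  shows "F \<in> sets (hausdorff_measure s)"
proof (cases "F = {}")
  case False
  let ?H = "hausdorff_outer s"
  have "?H (F \<inter> A) + ?H (A - F) \<le> ?H A" for A
  proof (cases "?H A = top")
    case fin: False
    define B where "B = (\<lambda>n. {x \<in> A. 1 / Suc n \<le> infdist x F})"
    define R where "R = (\<lambda>n. B (Suc n) - B n)"
    have Bmono: "B m \<subseteq> B n" if "m \<le> n" for m n
      using that by (auto simp: B_def elim!: order_trans[rotated] intro!: divide_left_mono)
    have RA: "R n \<subseteq> A" "B n \<subseteq> A" for n by (auto simp: R_def B_def)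
    have step: "?H (B (Suc n)) + ?H (R (Suc (Suc n))) \<le> ?H (B (Suc (Suc (Suc n))))" for n
    proof -
      have "1 / Suc (Suc n) - 1 / Suc (Suc (Suc n)) \<le> dist x y" if "x \<in> B (Suc n)" "y \<in> R (Suc (Suc n))" for x y
        using infdist_triangle[of x F y] that by (auto simp: B_def R_def)
      moreover have "0 < 1 / real (Suc (Suc n)) - 1 / real (Suc (Suc (Suc n)))"
        by (simp add: frac_less2)
      ultimately have "?H (B (Suc n)) + ?H (R (Suc (Suc n))) \<le> ?H (B (Suc n) \<union> R (Suc (Suc n)))"
        by (rule hausdorff_outer_separated[rotated])
      also have "\<dots> \<le> ?H (B (Suc (Suc (Suc n))))"
        by (intro hausdorff_outer_mono) (use Bmono[of "Suc n" "Suc (Suc (Suc n))"] in \<open>auto simp: R_def\<close>)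
      finally show ?thesis .
    qed
    \<comment> \<open>Rings two steps apart have positive distance, so the sums over the even rings and over the odd
      rings are bounded by the measure of \<open>A\<close>.\<close>
    have alt: "(\<Sum>i<Suc n. ?H (R (2 * i + j))) \<le> ?H (B (Suc (2 * n + j)))" for n j
    proof (induction n)
      case 0
      show ?case by (auto intro!: hausdorff_outer_mono simp: R_def)
    next
      case (Suc n)
      have "(\<Sum>i<Suc (Suc n). ?H (R (2 * i + j))) \<le> ?H (B (Suc (2 * n + j))) + ?H (R (Suc (Suc (2 * n + j))))"
        using Suc by (auto intro: add_mono)
      also have "\<dots> \<le> ?H (B (Suc (2 * Suc n + j)))" using step[of "2 * n + j"] by simp
      finally show ?case .
    qed
    have alt': "(\<Sum>i<n. ?H (R (2 * i + j))) \<le> ?H A" for n j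
    proof -
      have "(\<Sum>i<n. ?H (R (2 * i + j))) \<le> (\<Sum>i<Suc n. ?H (R (2 * i + j)))" by simp
      also have "\<dots> \<le> ?H A" using alt[of j n] hausdorff_outer_mono[OF RA(2), of s] order_trans by blast
      finally show ?thesis .
    qed
    have "(\<Sum>i. ?H (R i)) \<le> ?H A + ?H A"
    proof (rule suminf_le_const)
      fix n
      have eo: "(\<Sum>i<2 * n. ?H (R i)) = (\<Sum>i<n. ?H (R (2 * i + 0))) + (\<Sum>i<n. ?H (R (2 * i + 1)))"
        by (induction n) (auto simp: ac_simps)
      have "(\<Sum>i<n. ?H (R i)) \<le> (\<Sum>i<2 * n. ?H (R i))" by (rule sum_mono2) auto
      also have "\<dots> \<le> ?H A + ?H A" unfolding eo by (intro add_mono alt')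
      finally show "(\<Sum>i<n. ?H (R i)) \<le> ?H A + ?H A" .
    qed simp
    then have sfin: "(\<Sum>i. ?H (R i)) \<noteq> top" using fin by (auto simp: top_unique)
    define g where "g = (\<lambda>i. enn2real (?H (R i)))"
    have g: "?H (R i) = ennreal (g i)" "g i \<ge> 0" for i
    proof -
      have "?H (R i) \<noteq> top" using fin hausdorff_outer_mono[OF RA(1), of s i] by (metis top_unique)
      then show "?H (R i) = ennreal (g i)" by (simp add: g_def less_top)
    qed (simp add: g_def)
    have sg: "summable g" using sfin by (intro summable_suminf_not_top) (auto simp: g)
    have tail: "(\<lambda>m. ?H A + ennreal (\<Sum>i. g (i + m))) \<longlonglongrightarrow> ?H A + ennreal 0"
      by (intro tendsto_intros suminf_exist_split2 sg)
    have "?H (F \<inter> A) + ?H (A - F) \<le> ?H A + ennreal (\<Sum>i. g (i + m))" for m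
    proof -
      have "A - F \<subseteq> B m \<union> (\<Union>i. R (i + m))"
      proof
        fix x assume x: "x \<in> A - F"
        then have "infdist x F > 0" using assms False by (simp add: infdist_pos_not_in_closed)
        then obtain n where n: "inverse (real (Suc n)) < infdist x F" using reals_Archimedean by blast
        then have xB: "x \<in> B n" using x by (simp add: B_def inverse_eq_divide)
        define l where "l = (LEAST n. x \<in> B n)"
        have l: "x \<in> B l" "\<And>j. j < l \<Longrightarrow> x \<notin> B j" unfolding l_def using xB by (auto intro: LeastI dest: not_less_Least)
        show "x \<in> B m \<union> (\<Union>i. R (i + m))"
        proof (cases "l \<le> m")
          case True then show ?thesis using Bmono l by blast
        next
          case False
          then have "x \<in> R ((l - 1 - m) + m)" using l by (auto simp: R_def)
          then show ?thesis by blast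
        qed
      qed
      then have "?H (A - F) \<le> ?H (B m) + (\<Sum>i. ?H (R (i + m)))"
        using hausdorff_outer_mono[of "A - F" _ s] hausdorff_outer_Un[of s "B m" "\<Union>i. R (i + m)"]
          hausdorff_outer_UN[of s "\<lambda>i. R (i + m)"]
        by (meson add_left_mono order_trans)
      also have "(\<Sum>i. ?H (R (i + m))) = ennreal (\<Sum>i. g (i + m))"
        unfolding g(1) by (intro suminf_ennreal2 g) (use sg in \<open>simp add: summable_iff_shift\<close>)
      finally have "?H (F \<inter> A) + ?H (A - F) \<le> (?H (F \<inter> A) + ?H (B m)) + ennreal (\<Sum>i. g (i + m))"
        by (simp add: add.assoc add_left_mono)
      also have "?H (F \<inter> A) + ?H (B m) \<le> ?H ((F \<inter> A) \<union> B m)"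
      proof (rule hausdorff_outer_separated[where d="1 / Suc m"])
        show "1 / Suc m \<le> dist x y" if "x \<in> F \<inter> A" "y \<in> B m" for x y
          using that infdist_le[of x F y] by (auto simp: B_def dist_commute)
      qed simp
      also have "\<dots> \<le> ?H A" by (intro hausdorff_outer_mono) (auto simp: B_def)
      finally show ?thesis by (simp add: add_right_mono)
    qed
    then show ?thesis
      using tendsto_lowerbound[OF tail] by (auto intro: always_eventually)
  qed simp
  moreover have "?H A \<le> ?H (F \<inter> A) + ?H (A - F)" for A
    using hausdorff_outer_Un[of s "F \<inter> A" "A - F"] by (simp add: Int_Diff_Un Int_commute)
  ultimately have "?H (F \<inter> A) + ?H (A - F) = ?H A" for A by (simp add: antisym)
  moreover have "(UNIV - F) \<inter> A = A - F" for A by blast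
  ultimately show ?thesis
    unfolding sets_hausdorff_measure lambda_system_def by simp
qed simp

lemma space_hausdorff_measure [simp]: "space (hausdorff_measure s) = UNIV"
  unfolding hausdorff_measure_def by simp

lemma sets_borel_subset_hausdorff: "sets (borel :: 'a::metric_space measure) \<subseteq> sets (hausdorff_measure s)"
proof -
  have "sigma_sets UNIV (Collect closed) \<subseteq> sets (hausdorff_measure s :: 'a measure)"
    using sets.sigma_sets_subset[of "Collect closed" "hausdorff_measure s :: 'a measure"]
      closed_in_sets_hausdorff_measure by auto
  then show ?thesis by (simp add: borel_eq_closed)
qed

lemma borel_measurable_hausdorff:
  "f \<in> measurable borel N \<Longrightarrow> f \<in> measurable (hausdorff_measure s :: 'a::metric_space measure) N"
  using sets_borel_subset_hausdorff[where 'a='a] unfolding measurable_def by auto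

section \<open>One-dimensional Hausdorff measure on lines\<close>

lemma hausdorff_cost_1: "hausdorff_cost 1 U = ennreal (diameter U)"
  by (simp add: hausdorff_cost_def unit_ball_vol_1)

text \<open>
  An isometric embedding \<open>e\<close> of the real line together with a retraction \<open>p\<close> that does not increase
  distances, which plays the role of the orthogonal projection onto the line.
\<close>
locale isometric_line =
  fixes e :: "real \<Rightarrow> 'a::metric_space" and p :: "'a \<Rightarrow> real"
  assumes e_dist: "dist (e s) (e t) = \<bar>s - t\<bar>"
    and p_dist: "\<bar>p x - p y\<bar> \<le> dist x y"
    and p_e: "p (e t) = t"
begin

lemma continuous_e: "continuous_on UNIV e"
  unfolding continuous_on_iff by (auto simp: e_dist dist_real_def)

lemma continuous_p: "continuous_on UNIV p"
  unfolding continuous_on_iff dist_real_def using p_dist by (meson le_less_trans)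

lemma image_e: "e ` I = range e \<inter> p -` I"
  using p_e by (auto simp: image_iff)

lemma closed_range_e: "closed (range e)"
proof -
  have "range e = {x. e (p x) = x}" using p_e by (auto simp: image_iff) (metis)
  then show ?thesis
    using closed_Collect_eq[OF continuous_on_compose2[OF continuous_e continuous_p] continuous_on_id] by simp
qed

lemma e_measurable [measurable]: "e \<in> borel_measurable borel" and p_measurable [measurable]: "p \<in> borel_measurable borel"
  using borel_measurable_continuous_onI continuous_e continuous_p by blast+

lemma image_e_borel: "I \<in> sets borel \<Longrightarrow> e ` I \<in> sets borel"
  unfolding image_e[of I] using closed_range_e measurable_sets[OF p_measurable] by (auto intro: sets.Int)

text \<open>
  The retraction maps each covering set into an interval that is no longer than its diameter, and
  countably many intervals that cover \<open>{l<..<u}\<close> have total length at least \<open>u - l\<close>.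
\<close>
lemma hausdorff_outer_segment_ge: "ennreal (u - l) \<le> hausdorff_outer 1 (e ` {l<..<u})"
proof (cases "l \<le> u")
  case lu: True
  have "ennreal (u - l) \<le> hausdorff_content 1 1 (e ` {l<..<u})"
    unfolding hausdorff_content_def
  proof (rule INF_greatest)
    fix U :: "nat \<Rightarrow> 'a set"
    assume "U \<in> {U. e ` {l<..<u} \<subseteq> \<Union> (range U) \<and> (\<forall>i. bounded (U i) \<and> diameter (U i) \<le> 1)}"
    then have cov: "e ` {l<..<u} \<subseteq> (\<Union>i. U i)" and U: "\<And>i. bounded (U i)" by auto
    define J where "J = (\<lambda>i. if U i = {} then {} else {Inf (p ` U i)..Sup (p ` U i)})"
    have J: "p ` U i \<subseteq> J i \<and> emeasure lborel (J i) \<le> hausdorff_cost 1 (U i)" for i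
    proof (cases "U i = {}")
      case False
      have d: "\<bar>p x - p y\<bar> \<le> diameter (U i)" if "x \<in> U i" "y \<in> U i" for x y
        using p_dist diameter_bounded_bound[OF U that] order_trans by blast
      obtain x0 where x0: "x0 \<in> U i" using False by blast
      have bd: "bdd_below (p ` U i)" "bdd_above (p ` U i)"
        by (rule bdd_belowI2[of _ "p x0 - diameter (U i)"], use d[OF x0] in force)
           (rule bdd_aboveI2[of _ _ "p x0 + diameter (U i)"], use d[OF x0] in force)
      have "p ` U i \<subseteq> J i" using False cInf_lower[OF _ bd(1)] cSup_upper[OF _ bd(2)] by (force simp: J_def)
      moreover have "Sup (p ` U i) \<le> Inf (p ` U i) + diameter (U i)"
      proof (rule cSup_least)
        fix y assume "y \<in> p ` U i"
        then obtain y' where y: "y = p y'" "y' \<in> U i" by blast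
        have "y - diameter (U i) \<le> Inf (p ` U i)"
          by (rule cInf_greatest) (use False d[OF y(2)] y in \<open>force\<close>)+
        then show "y \<le> Inf (p ` U i) + diameter (U i)" by simp
      qed (use False in auto)
      moreover have "Inf (p ` U i) \<le> Sup (p ` U i)"
        using False bd by (intro cInf_le_cSup) auto
      ultimately show ?thesis
        unfolding hausdorff_cost_1 using False by (auto simp: J_def intro!: ennreal_leI)
    qed (simp add: J_def)
    have "{l<..<u} \<subseteq> (\<Union>i. J i)"
    proof
      fix t assume "t \<in> {l<..<u}"
      then obtain i where "e t \<in> U i" using cov by blast
      then show "t \<in> (\<Union>i. J i)" using J[of i] p_e[of t] by (force simp: image_subset_iff)
    qed
    moreover have Jm: "range J \<subseteq> sets lborel" by (auto simp: J_def)
    ultimately have "emeasure lborel {l<..<u} \<le> emeasure lborel (\<Union>i. J i)"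
      by (intro emeasure_mono) auto
    also have "\<dots> \<le> (\<Sum>i. emeasure lborel (J i))" by (rule emeasure_subadditive_countably[OF Jm])
    also have "\<dots> \<le> (\<Sum>i. hausdorff_cost 1 (U i))" using J by (intro suminf_le) auto
    finally show "ennreal (u - l) \<le> (\<Sum>i. hausdorff_cost 1 (U i))" using lu by simp
  qed
  also have "\<dots> \<le> hausdorff_outer 1 (e ` {l<..<u})"
    unfolding hausdorff_outer_def by (rule SUP_upper) auto
  finally show ?thesis .
qed (simp add: ennreal_neg)

lemma hausdorff_outer_segment_le:
  assumes "l < u"
  shows "hausdorff_outer 1 (e ` {l<..<u}) \<le> ennreal (u - l)"
  unfolding hausdorff_outer_def
proof (rule SUP_least)
  fix \<delta> :: real assume "\<delta> \<in> {0<..}"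
  then have \<delta>: "\<delta> > 0" by simp
  obtain n :: nat where n: "n > 0" "(u - l) / \<delta> < n"
    using reals_Archimedean2 assms \<delta> by (metis divide_pos_pos diff_gt_0_iff_gt of_nat_0_less_iff less_trans)
  define h where "h = (u - l) / n"
  have h: "h > 0" "h \<le> \<delta>" "real n * h = u - l"
    using assms n \<delta> by (auto simp: h_def field_simps)
  define U where "U = (\<lambda>i::nat. if i < n then e ` {l + i * h..l + (i + 1) * h} else {})"
  have dU: "diameter (U i) \<le> h" for i
  proof (cases "i < n")
    case True
    have "dist x y \<le> h" if "x \<in> U i" "y \<in> U i" for x y
      using that True by (auto simp: U_def e_dist abs_le_iff algebra_simps)
    moreover have "U i \<noteq> {}" using True h by (auto simp: U_def)
    ultimately show ?thesis by (auto simp: diameter_def intro!: cSUP_least)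
  qed (use h in \<open>simp add: U_def\<close>)
  have bU: "bounded (U i)" for i
    using compact_continuous_image[OF continuous_on_subset[OF continuous_e], of "{l + i * h..l + (i + 1) * h}"]
    by (auto simp: U_def compact_imp_bounded)
  have cov: "e ` {l<..<u} \<subseteq> (\<Union>i. U i)"
  proof
    fix x assume "x \<in> e ` {l<..<u}"
    then obtain t where t: "x = e t" "l < t" "t < u" by auto
    define i where "i = nat \<lfloor>(t - l) / h\<rfloor>"
    have pos: "(t - l) / h > 0" using t h by simp
    have i: "real i \<le> (t - l) / h" "(t - l) / h < real i + 1" using pos by (auto simp: i_def)
    have "(t - l) / h < n" using t h by (simp add: divide_less_eq)
    then have "i < n" using i by linarith
    moreover have "t \<in> {l + i * h..l + (i + 1) * h}" using i h by (simp add: field_simps)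
    ultimately have "x \<in> U i" using t by (simp add: U_def)
    then show "x \<in> (\<Union>i. U i)" by blast
  qed
  have "hausdorff_content 1 \<delta> (e ` {l<..<u}) \<le> (\<Sum>i. hausdorff_cost 1 (U i))"
    unfolding hausdorff_content_def
    by (rule INF_lower) (use cov bU order_trans[OF dU h(2)] in auto)
  also have "\<dots> = (\<Sum>i<n. hausdorff_cost 1 (U i))"
    by (rule suminf_finite) (auto simp: U_def hausdorff_cost_def)
  also have "\<dots> \<le> (\<Sum>i<n. ennreal h)"
    unfolding hausdorff_cost_1 by (intro sum_mono ennreal_leI dU)
  also have "\<dots> = ennreal (u - l)"
    using h by (simp add: ennreal_of_nat_eq_real_of_nat ennreal_mult[symmetric] flip: h(3))
  finally show "hausdorff_content 1 \<delta> (e ` {l<..<u}) \<le> ennreal (u - l)" .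
qed

text \<open>
  Lebesgue measure is characterised by the measure of open intervals.
\<close>
lemma lborel_eq_distr_hausdorff:
  "lborel = distr (restrict_space (hausdorff_measure 1) (range e)) borel p" (is "_ = ?M")
proof (rule lborel_eqI)
  have p: "p \<in> measurable (restrict_space (hausdorff_measure 1) (range e)) borel"
    by (intro measurable_restrict_space1 borel_measurable_hausdorff p_measurable)
  have rm: "range e \<in> sets (hausdorff_measure 1)" by (rule closed_in_sets_hausdorff_measure[OF closed_range_e])
  fix l u :: real
  assume "\<And>b. b \<in> Basis \<Longrightarrow> l \<bullet> b \<le> u \<bullet> b"
  then have lu: "l \<le> u" by simp
  have "emeasure ?M (box l u) = emeasure (restrict_space (hausdorff_measure 1) (range e)) (p -` {l<..<u} \<inter> range e)"
    using p by (simp add: emeasure_distr space_restrict_space box_real)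
  also have "\<dots> = emeasure (hausdorff_measure 1) (e ` {l<..<u})"
    using rm by (subst emeasure_restrict_space) (simp_all add: image_e[of "{l<..<u}"] Int_commute)
  also have "\<dots> = hausdorff_outer 1 (e ` {l<..<u})"
    by (intro emeasure_hausdorff_measure subsetD[OF sets_borel_subset_hausdorff] image_e_borel) auto
  also have "\<dots> = ennreal (u - l)"
    using hausdorff_outer_segment_ge[of u l] hausdorff_outer_segment_le[of l u] lu
    by (cases "l = u") (auto simp: hausdorff_outer_empty intro: antisym)
  finally show "emeasure ?M (box l u) = ennreal (\<Prod>b\<in>Basis. (u - l) \<bullet> b)" by simp
qed simp

lemma has_integral_hausdorff_line:
  fixes f :: "'a \<Rightarrow> real"
  assumes [measurable]: "f \<in> borel_measurable borel" "I \<in> sets borel"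
  shows "has_bochner_integral (hausdorff_measure 1) (\<lambda>x. indicator (e ` I) x * f x) c \<longleftrightarrow>
         has_bochner_integral lborel (\<lambda>t. indicator I t * f (e t)) c"
proof -
  let ?R = "restrict_space (hausdorff_measure 1) (range e)"
  have p: "p \<in> measurable ?R borel"
    by (intro measurable_restrict_space1 borel_measurable_hausdorff p_measurable)
  have rm: "range e \<inter> space (hausdorff_measure 1) \<in> sets (hausdorff_measure 1)"
    using closed_in_sets_hausdorff_measure[OF closed_range_e] by simp
  let ?h = "\<lambda>t. indicator I t * f (e t)"
  have h: "?h \<in> borel_measurable borel" by measurable
  have eq: "indicator (range e) x *\<^sub>R ?h (p x) = indicator (e ` I) x * f x" for x
    by (auto simp: image_e[of I] p_e split: split_indicator)
  have "integrable lborel ?h \<longleftrightarrow> integrable (hausdorff_measure 1) (\<lambda>x. indicator (e ` I) x * f x)"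
    by (subst lborel_eq_distr_hausdorff, subst integrable_distr_eq[OF p h], subst integrable_restrict_space[OF rm], subst eq) simp
  moreover have "integral\<^sup>L lborel ?h = integral\<^sup>L (hausdorff_measure 1) (\<lambda>x. indicator (e ` I) x * f x)"
    by (subst lborel_eq_distr_hausdorff, subst integral_distr[OF p h], subst integral_restrict_space[OF rm], subst eq) simp
  ultimately show ?thesis by (simp add: has_bochner_integral_iff)
qed

end

section \<open>Integrals over the boundary of a rectangle\<close>

lemma has_bochner_integral_interval:
  fixes f :: "real \<Rightarrow> real"
  assumes "continuous_on {l..r} f" and I: "{l<..<r} \<subseteq> I" "I \<subseteq> {l..r}" "I \<in> sets borel"
  shows "has_bochner_integral lborel (\<lambda>t. indicator I t * f t) (integral {l..r} f)"
proof -
  have "set_integrable lborel {l..r} f" by (rule borel_integrable_atLeastAtMost'[OF assms(1)])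
  then have si: "set_integrable lborel I f" by (rule set_integrable_subset) (use I in auto)
  have "integral I f = integral {l..r} f"
  proof (rule integral_spike_set)
    have "I - {l..r} = {}" "{l..r} - I \<subseteq> {l..r} - {l<..<r}" using I by blast+
    moreover have "{l..r} - {l<..<r} \<subseteq> {l, r}" by auto
    ultimately have "I - {l..r} = {}" "{l..r} - I \<subseteq> {l, r}" by blast+
    then show "negligible {x \<in> I - {l..r}. f x \<noteq> 0}" "negligible {x \<in> {l..r} - I. f x \<noteq> 0}"
      by (rule_tac negligible_subset[of "{l, r}"], simp, blast)+
  qed
  then show ?thesis
    using si set_borel_integral_eq_integral(2)[OF si]
    by (simp add: has_bochner_integral_iff set_integrable_def set_lebesgue_integral_def)
qed

lemma isometric_line_horizontal: "isometric_line (\<lambda>t. (t, c)) (fst :: real \<times> real \<Rightarrow> real)"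
  by standard (auto simp: dist_Pair_Pair dist_real_def dist_fst_le[unfolded dist_real_def])

lemma isometric_line_vertical: "isometric_line (\<lambda>t. (c, t)) (snd :: real \<times> real \<Rightarrow> real)"
  by standard (auto simp: dist_Pair_Pair dist_real_def dist_snd_le[unfolded dist_real_def])

lemma rectangle_eq_box: "{-a<..<a} \<times> {-b<..<b} = box (-a, -b) (a, b :: real)" for a b :: real
  by (auto simp: box_def Basis_prod_def)

text \<open>
  The corners are distributed so that the four half-open edges are disjoint.
\<close>
lemma frontier_rectangle:
  fixes a b :: real
  assumes "a > 0" "b > 0"
  shows "frontier (box (-a, -b) (a, b)) = (\<lambda>t. (t, -b)) ` {-a..<a} \<union> (\<lambda>t. (a, t)) ` {-b..<b} \<union>
      (\<lambda>t. (t, b)) ` {-a<..a} \<union> (\<lambda>t. (-a, t)) ` {-b<..b}"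
proof -
  have "box (-a, -b) (a, b) \<noteq> {}" using assms by (auto simp: rectangle_eq_box[symmetric])
  then have "frontier (box (-a, -b) (a, b)) = {-a..a} \<times> {-b..b} - {-a<..<a} \<times> {-b<..<b}"
    by (simp add: frontier_box cbox_Pair_eq rectangle_eq_box)
  also have "\<dots> = (\<lambda>t. (t, -b)) ` {-a..<a} \<union> (\<lambda>t. (a, t)) ` {-b..<b} \<union>
      (\<lambda>t. (t, b)) ` {-a<..a} \<union> (\<lambda>t. (-a, t)) ` {-b<..b}"
    using assms by (auto simp: image_iff)
  finally show ?thesis .
qed

lemma has_boundary_integral_rectangle:
  fixes u :: "real \<times> real \<Rightarrow> real"
  assumes ab: "a > 0" "b > 0" and u: "continuous_on UNIV u"
  shows "has_bochner_integral (surface_measure (frontier (box (-a, -b) (a, b)))) u (edge_integral a b u)"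
proof -
  let ?G = "frontier (box (-a, -b) (a, b))"
  let ?H = "hausdorff_measure 1 :: (real \<times> real) measure"
  let ?E1 = "(\<lambda>t. (t, -b)) ` {-a..<a}" and ?E2 = "(\<lambda>t. (a, t)) ` {-b..<b}"
    and ?E3 = "(\<lambda>t. (t, b)) ` {-a<..a}" and ?E4 = "(\<lambda>t. (-a, t)) ` {-b<..b}"
  have um: "u \<in> borel_measurable borel" by (rule borel_measurable_continuous_onI[OF u])
  have c1: "continuous_on S (\<lambda>t. u (t, c))" and c2: "continuous_on S (\<lambda>t. u (c, t))" for S c
    by (rule continuous_on_compose2[OF u], auto intro!: continuous_intros)+
  note i = isometric_line.has_integral_hausdorff_line[OF isometric_line_horizontal um, THEN iffD2, OF _ has_bochner_integral_interval]
    isometric_line.has_integral_hausdorff_line[OF isometric_line_vertical um, THEN iffD2, OF _ has_bochner_integral_interval]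
  have "has_bochner_integral ?H (\<lambda>x. indicator ?E1 x * u x + indicator ?E2 x * u x + indicator ?E3 x * u x + indicator ?E4 x * u x)
     (integral {-a..a} (\<lambda>t. u (t, -b)) + integral {-b..b} (\<lambda>t. u (a, t)) + integral {-a..a} (\<lambda>t. u (t, b)) + integral {-b..b} (\<lambda>t. u (-a, t)))"
    by (intro has_bochner_integral_add i c1 c2) auto
  also have "(\<lambda>x. indicator ?E1 x * u x + indicator ?E2 x * u x + indicator ?E3 x * u x + indicator ?E4 x * u x)
    = (\<lambda>x. indicator ?G x *\<^sub>R u x)"
    unfolding frontier_rectangle[OF ab]
    using ab by (intro ext) (auto split: split_indicator)
  also have "(integral {-a..a} (\<lambda>t. u (t, -b)) + integral {-b..b} (\<lambda>t. u (a, t)) + integral {-a..a} (\<lambda>t. u (t, b)) + integral {-b..b} (\<lambda>t. u (-a, t)))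
     = edge_integral a b u"
    unfolding edge_integral_def
    by (subst (1 2) integral_add) (auto intro!: integrable_continuous_real c1 c2)
  finally have "has_bochner_integral ?H (\<lambda>x. indicator ?G x *\<^sub>R u x) (edge_integral a b u)" .
  then show ?thesis
    using closed_in_sets_hausdorff_measure[of ?G 1]
    by (simp add: surface_measure_def has_bochner_integral_restrict_space)
qed

lemma
  assumes ab: "a > 0" "b > 0"
  shows finite_measure_boundary_rectangle: "finite_measure (surface_measure (frontier (box (-a, -b) (a, b :: real))))"
    and measure_boundary_rectangle: "measure (surface_measure (frontier (box (-a, -b) (a, b)))) (frontier (box (-a, -b) (a, b))) = 4 * (a + b)"
proof -
  let ?M = "surface_measure (frontier (box (-a, -b) (a, b)))"
  have sp: "space ?M = frontier (box (-a, -b) (a, b))"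
    by (simp add: surface_measure_def space_restrict_space)
  have 1: "has_bochner_integral ?M (\<lambda>_. 1 :: real) (4 * (a + b))"
    using has_boundary_integral_rectangle[OF ab, of "\<lambda>_. 1"] ab by (simp add: edge_integral_def algebra_simps)
  then show "finite_measure ?M"
    by (intro finite_measureI) (auto simp: has_bochner_integral_iff integrable_iff_bounded)
  show "measure ?M (frontier (box (-a, -b) (a, b))) = 4 * (a + b)"
    using 1 by (simp add: has_bochner_integral_iff sp)
qed

section \<open>Smooth functions\<close>

lemma partial_deriv_eqI:
  "(f has_derivative D) (at x) \<Longrightarrow> partial_deriv b f x = D b"
  unfolding partial_deriv_def by (simp add: frechet_derivative_at[symmetric])

lemma C_k_Suc_imp_C_k: "C_k (Suc k) f \<Longrightarrow> C_k k f"
proof (induction k arbitrary: f)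
  case 0
  then show ?case
    by (simp add: continuous_on_eq_continuous_at differentiable_imp_continuous_within)
next
  case (Suc k)
  then show ?case by (metis C_k.simps(2))
qed

lemma C_k_const: "C_k k (\<lambda>_. c)"
proof (induction k arbitrary: c)
  case (Suc k)
  have "partial_deriv b (\<lambda>_::'a. c) = (\<lambda>_. 0)" for b
    by (rule ext, rule partial_deriv_eqI, rule has_derivative_const)
  then show ?case using Suc by simp
qed simp

lemma has_derivative_partial_deriv:
  "f differentiable (at x) \<Longrightarrow> (f has_derivative (\<lambda>h. partial_deriv h f x)) (at x)"
  unfolding partial_deriv_def by (simp add: frechet_derivative_works[symmetric])

lemma partial_deriv_add:
  assumes "f differentiable (at x)" "g differentiable (at x)"
  shows "partial_deriv b (\<lambda>x. f x + g x) x = partial_deriv b f x + partial_deriv b g x"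
  by (rule partial_deriv_eqI) (intro has_derivative_add has_derivative_partial_deriv assms)

lemma partial_deriv_mult:
  assumes "f differentiable (at x)" "g differentiable (at x)"
  shows "partial_deriv b (\<lambda>x. f x * g x) x = f x * partial_deriv b g x + partial_deriv b f x * g x"
  by (rule partial_deriv_eqI) (intro has_derivative_mult has_derivative_partial_deriv assms)

lemma C_k_add: "C_k k f \<Longrightarrow> C_k k g \<Longrightarrow> C_k k (\<lambda>x. f x + g x)"
proof (induction k arbitrary: f g)
  case (Suc k)
  then have "partial_deriv b (\<lambda>x. f x + g x) = (\<lambda>x. partial_deriv b f x + partial_deriv b g x)" for b
    by (intro ext partial_deriv_add) auto
  with Suc show ?case by auto
qed (auto intro: continuous_intros)

lemma C_k_mult: "C_k k f \<Longrightarrow> C_k k g \<Longrightarrow> C_k k (\<lambda>x. f x * g x)"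
proof (induction k arbitrary: f g)
  case (Suc k)
  then have "partial_deriv b (\<lambda>x. f x * g x) = (\<lambda>x. f x * partial_deriv b g x + partial_deriv b f x * g x)" for b
    by (intro ext partial_deriv_mult) auto
  moreover have "C_k k f" "C_k k g" using Suc.prems C_k_Suc_imp_C_k by auto
  ultimately show ?case using Suc by (auto intro!: C_k_add)
qed (auto intro: continuous_intros)

text \<open>
  Differentiating a ridge function produces a multiple of a ridge function with the next profile, so a
  sequence of profiles each of which is the derivative of its predecessor gives smoothness.
\<close>
lemma C_k_ridge:
  fixes F :: "nat \<Rightarrow> real \<Rightarrow> real"
  assumes F: "\<And>n t. (F n has_real_derivative F (Suc n) t) (at t)"
  shows "C_k k (\<lambda>z. r * F n (v \<bullet> z + c))"
proof (induction k arbitrary: r n)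
  case 0
  have "continuous_on UNIV (F n)"
    by (meson DERIV_continuous_on F has_field_derivative_at_within)
  then have "continuous_on UNIV (\<lambda>z. F n (v \<bullet> z + c))"
    by (rule continuous_on_compose2) (auto intro!: continuous_intros)
  then show ?case by (auto intro: continuous_intros)
next
  case (Suc k)
  have d: "((\<lambda>z. r * F n (v \<bullet> z + c)) has_derivative (\<lambda>h. r * (v \<bullet> h) * F (Suc n) (v \<bullet> z + c))) (at z)" for z
  proof -
    have "((\<lambda>z. v \<bullet> z + c) has_derivative (\<lambda>h. v \<bullet> h)) (at z)"
      by (auto intro!: derivative_eq_intros)
    from DERIV_compose_FDERIV[OF F this] have "((\<lambda>z. F n (v \<bullet> z + c)) has_derivative (\<lambda>h. (v \<bullet> h) * F (Suc n) (v \<bullet> z + c))) (at z)" .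
    from has_derivative_mult_right[OF this, of r] show ?thesis by (simp add: mult_ac)
  qed
  have "partial_deriv b (\<lambda>z. r * F n (v \<bullet> z + c)) = (\<lambda>z. r * (v \<bullet> b) * F (Suc n) (v \<bullet> z + c))" for b
    by (rule ext, rule partial_deriv_eqI[OF d])
  moreover have "(\<lambda>z. r * F n (v \<bullet> z + c)) differentiable (at z)" for z
    using d differentiable_def by blast
  ultimately show ?case using Suc by simp
qed

lemma smooth_ridge:
  assumes "\<And>n t. (F n has_real_derivative F (Suc n) t) (at t)"
  shows "smooth (\<lambda>z. F 0 (v \<bullet> z + c))"
proof -
  have "C_k k (\<lambda>z. 1 * F 0 (v \<bullet> z + c))" for k
    by (rule C_k_ridge[where F=F and n=0, OF assms])
  then show ?thesis by (simp add: smooth_def)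
qed

lemma smooth_mult: "smooth f \<Longrightarrow> smooth g \<Longrightarrow> smooth (\<lambda>x. f x * g x)"
  by (simp add: smooth_def C_k_mult)

lemma smooth_prod: "finite I \<Longrightarrow> (\<And>i. i \<in> I \<Longrightarrow> smooth (f i)) \<Longrightarrow> smooth (\<lambda>x. \<Prod>i\<in>I. f i x)"
proof (induction I rule: finite_induct)
  case (insert i I)
  then have "smooth (\<lambda>x. f i x * (\<Prod>i\<in>I. f i x))" by (intro smooth_mult) auto
  then show ?case using insert.hyps by simp
qed (simp add: smooth_def C_k_const)

lemma smooth_differentiable: "smooth f \<Longrightarrow> f differentiable (at x)"
  unfolding smooth_def by (metis C_k.simps(2))

lemma smooth_continuous: "smooth f \<Longrightarrow> continuous_on UNIV f"
  unfolding smooth_def by (metis C_k.simps(1))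

lemma smooth_partial_deriv: "smooth f \<Longrightarrow> b \<in> Basis \<Longrightarrow> smooth (partial_deriv b f)"
  unfolding smooth_def by (metis C_k.simps(2))

section \<open>Smooth approximations of indicator functions of boxes\<close>

text \<open>
  Prefactors that are polynomials in \<open>1/t\<close> make the family of these functions, which are flat at \<open>0\<close>,
  closed under differentiation.
\<close>
definition flat_exp :: "real poly \<Rightarrow> real \<Rightarrow> real" where
  "flat_exp p t = (if t > 0 then poly p (1 / t) * exp (- 1 / t) else 0)"

lemma tendsto_poly_div_exp: "((\<lambda>x. poly p x / exp x) \<longlongrightarrow> (0::real)) at_top"
proof -
  have "((\<lambda>x. \<Sum>i\<le>degree p. coeff p i * (x ^ i / exp x)) \<longlongrightarrow> (\<Sum>i\<le>degree p. coeff p i * 0)) at_top"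
    by (intro tendsto_intros tendsto_power_div_exp_0)
  then show ?thesis by (simp add: poly_altdef sum_divide_distrib)
qed

lemma flat_exp_derivative:
  "(flat_exp p has_real_derivative flat_exp (monom 1 2 * (p - pderiv p)) t) (at t)"
proof -
  consider "t > 0" | "t < 0" | "t = 0" by linarith
  then show ?thesis
  proof cases
    case 1
    have "((\<lambda>t. poly p (1 / t) * exp (- 1 / t)) has_real_derivative flat_exp (monom 1 2 * (p - pderiv p)) t) (at t)"
      using 1
      by (auto intro!: derivative_eq_intros DERIV_chain'[where g="poly p", OF _ poly_DERIV]
          simp: flat_exp_def poly_monom power2_eq_square field_simps)
    then show ?thesis
      by (rule has_field_derivative_transform_within_open[of _ _ _ "{0<..}"])
         (use 1 in \<open>auto simp: flat_exp_def\<close>)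
  next
    case 2
    have "((\<lambda>t. 0) has_real_derivative flat_exp (monom 1 2 * (p - pderiv p)) t) (at t)"
      using 2 by (auto simp: flat_exp_def)
    then show ?thesis
      by (rule has_field_derivative_transform_within_open[of _ _ _ "{..<0}"])
         (use 2 in \<open>auto simp: flat_exp_def\<close>)
  next
    case 3
    have "((\<lambda>x. flat_exp p x / x) \<longlongrightarrow> 0) (at 0)"
    proof (rule filterlim_split_at)
      show "((\<lambda>x. flat_exp p x / x) \<longlongrightarrow> 0) (at_left 0)"
        by (rule tendsto_eventually) (auto simp: flat_exp_def eventually_at_left_field intro: exI[of _ "-1"])
      have "((\<lambda>x. poly (pCons 0 p) x / exp x) \<longlongrightarrow> 0) at_top" by (rule tendsto_poly_div_exp)
      moreover have "\<forall>\<^sub>F x in at_top. poly (pCons 0 p) x / exp x = flat_exp p (inverse x) / inverse x"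
        using eventually_gt_at_top[of 0]
        by eventually_elim (simp add: flat_exp_def exp_minus field_simps)
      ultimately show "((\<lambda>x. flat_exp p x / x) \<longlongrightarrow> 0) (at_right 0)"
        unfolding filterlim_at_right_to_top by (rule Lim_transform_eventually)
    qed
    then show ?thesis using 3 by (simp add: has_field_derivative_iff flat_exp_def)
  qed
qed

lemma smooth_flat_exp: "smooth (\<lambda>z. flat_exp 1 (v \<bullet> z + c))"
proof -
  define F where "F = (\<lambda>n. flat_exp (((\<lambda>p. monom 1 2 * (p - pderiv p)) ^^ n) 1))"
  have "smooth (\<lambda>z. F 0 (v \<bullet> z + c))"
    by (rule smooth_ridge[where F=F]) (simp add: F_def flat_exp_derivative)
  then show ?thesis by (simp add: F_def)
qed

lemma flat_exp_1_bounds: "0 \<le> flat_exp 1 t" "flat_exp 1 t \<le> 1" "flat_exp 1 t \<noteq> 0 \<longleftrightarrow> t > 0"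
  by (auto simp: flat_exp_def)

lemma flat_exp_1_tendsto: "(flat_exp 1 \<longlongrightarrow> 1) at_top"
proof -
  have "((\<lambda>t::real. exp (- 1 / t)) \<longlongrightarrow> exp 0) at_top"
    by (intro tendsto_exp tendsto_divide_0[OF tendsto_const] filterlim_at_top_imp_at_infinity filterlim_ident)
  moreover have "\<forall>\<^sub>F t in at_top. exp (- 1 / t) = flat_exp 1 t"
    using eventually_gt_at_top[of 0] by eventually_elim (simp add: flat_exp_def)
  ultimately show ?thesis by (auto intro: Lim_transform_eventually)
qed

text \<open>
  A factor for coordinate \<open>b\<close> is nonzero exactly when the point is more than \<open>1/n\<close> away from both faces
  orthogonal to \<open>b\<close>, so the support is a compact subset of the open box. The scaling by \<open>n\<close> lets every
  factor tend to \<open>1\<close> at interior points.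
\<close>
definition box_bump :: "'a::euclidean_space \<Rightarrow> 'a \<Rightarrow> nat \<Rightarrow> 'a \<Rightarrow> real" where
  "box_bump l r n z =
     (\<Prod>b\<in>Basis. flat_exp 1 (real n * ((z - l) \<bullet> b) - 1) * flat_exp 1 (real n * ((r - z) \<bullet> b) - 1))"

lemma smooth_box_bump: "smooth (box_bump l r n)"
proof -
  have "smooth (\<lambda>z. flat_exp 1 ((real n *\<^sub>R b) \<bullet> z + (- real n * (l \<bullet> b) - 1)) *
    flat_exp 1 ((- real n *\<^sub>R b) \<bullet> z + (real n * (r \<bullet> b) - 1)))" for b
    by (intro smooth_mult smooth_flat_exp)
  then show ?thesis
    unfolding box_bump_def
    by (intro smooth_prod) (auto simp: inner_diff_left algebra_simps inner_commute)
qed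

lemma box_bump_bounds: "0 \<le> box_bump l r n z" "box_bump l r n z \<le> 1"
  unfolding box_bump_def
  by (auto intro!: prod_nonneg prod_le_1 mult_nonneg_nonneg mult_le_one flat_exp_1_bounds)

lemma test_function_box_bump:
  assumes "n > 0"
  shows "test_function (box l r) (box_bump l r n)"
proof -
  have "{x. box_bump l r n x \<noteq> 0} \<subseteq> cbox (l + (1 / n) *\<^sub>R One) (r - (1 / n) *\<^sub>R One)"
    using assms by (auto simp: box_bump_def flat_exp_1_bounds(3) mem_box inner_simps field_simps less_imp_le)
  then have "closure {x. box_bump l r n x \<noteq> 0} \<subseteq> cbox (l + (1 / n) *\<^sub>R One) (r - (1 / n) *\<^sub>R One)"
    by (rule closure_minimal) (rule closed_cbox)
  moreover have "cbox (l + (1 / n) *\<^sub>R One) (r - (1 / n) *\<^sub>R One) \<subseteq> box l r"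
  proof
    fix x assume x: "x \<in> cbox (l + (1 / n) *\<^sub>R One) (r - (1 / n) *\<^sub>R One)"
    have "l \<bullet> b < x \<bullet> b \<and> x \<bullet> b < r \<bullet> b" if "b \<in> Basis" for b
    proof -
      have "l \<bullet> b + 1 / n \<le> x \<bullet> b \<and> x \<bullet> b \<le> r \<bullet> b - 1 / n"
        using x that by (simp add: mem_box inner_simps)
      moreover have "0 < 1 / real n" using assms by simp
      ultimately show ?thesis by linarith
    qed
    then show "x \<in> box l r" by (simp add: mem_box)
  qed
  moreover have "compact (closure {x. box_bump l r n x \<noteq> 0})"
    unfolding compact_eq_bounded_closed using calculation(1) bounded_subset[OF bounded_cbox] by blast
  ultimately show ?thesis
    unfolding test_function_def using smooth_box_bump by blast
qed

lemma test_function_mono: "test_function A f \<Longrightarrow> A \<subseteq> B \<Longrightarrow> test_function B f"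
  unfolding test_function_def by blast

lemma box_bump_tendsto: "(\<lambda>n. box_bump l r n z) \<longlonglongrightarrow> indicator (box l r) z"
proof (cases "z \<in> box l r")
  case True
  have lim: "(\<lambda>n. flat_exp 1 (real n * t - 1)) \<longlonglongrightarrow> 1" if "t > 0" for t
  proof (rule filterlim_compose[OF flat_exp_1_tendsto])
    have "filterlim (\<lambda>n. real n * t) at_top sequentially"
      using that by (intro filterlim_at_top_mult_tendsto_pos[OF tendsto_const] filterlim_real_sequentially) 
    then show "filterlim (\<lambda>n. real n * t - 1) at_top sequentially"
      using filterlim_tendsto_add_at_top[OF tendsto_const[of "-1"]] by fastforce
  qed
  have "(\<lambda>n. box_bump l r n z) \<longlonglongrightarrow> (\<Prod>b\<in>(Basis::'a set). 1 * 1)"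
    unfolding box_bump_def
    by (intro tendsto_prod tendsto_mult lim) (use True in \<open>auto simp: mem_box inner_simps\<close>)
  then show ?thesis using True by simp
next
  case False
  then obtain b where b: "b \<in> Basis" "(z - l) \<bullet> b \<le> 0 \<or> (r - z) \<bullet> b \<le> 0"
    by (auto simp: mem_box inner_simps not_less)
  have "flat_exp 1 (real n * ((z - l) \<bullet> b) - 1) * flat_exp 1 (real n * ((r - z) \<bullet> b) - 1) = 0" for n
    using b(2) mult_nonneg_nonpos[of "real n"] by (fastforce simp: flat_exp_def)
  then have "box_bump l r n z = 0" for n
    unfolding box_bump_def using b(1) by (intro prod_zero) auto
  then show ?thesis using False by simp
qed

section \<open>The \<open>L\<^sup>2\<close> norm\<close>

text \<open>
  Young's inequality; optimising over \<open>\<epsilon>\<close> after integration yields the triangle inequality in \<open>L\<^sup>2\<close>.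
\<close>
lemma norm_add_squared_le:
  fixes x y :: "'a::real_inner"
  assumes "\<epsilon> > 0"
  shows "(norm (x + y))\<^sup>2 \<le> (1 + \<epsilon>) * (norm x)\<^sup>2 + (1 + 1 / \<epsilon>) * (norm y)\<^sup>2"
proof -
  have "(norm (x + y))\<^sup>2 \<le> (norm x + norm y)\<^sup>2"
    by (intro power_mono norm_triangle_ineq) auto
  also have "\<dots> = (1 + \<epsilon>) * (norm x)\<^sup>2 + (1 + 1 / \<epsilon>) * (norm y)\<^sup>2 - \<epsilon> * (norm x - norm y / \<epsilon>)\<^sup>2"
  proof -
    have "\<epsilon> * (norm x - norm y / \<epsilon>)\<^sup>2 = \<epsilon> * (norm x)\<^sup>2 - 2 * norm x * norm y + 1 / \<epsilon> * (norm y)\<^sup>2"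
      using assms by (simp add: power2_eq_square field_simps)
    then show ?thesis by (simp add: power2_sum algebra_simps)
  qed
  also have "\<dots> \<le> (1 + \<epsilon>) * (norm x)\<^sup>2 + (1 + 1 / \<epsilon>) * (norm y)\<^sup>2"
    using assms by simp
  finally show ?thesis .
qed

lemma square_integrable_add:
  assumes "square_integrable M f" "square_integrable M g"
  shows "square_integrable M (\<lambda>x. f x + g x)"
proof -
  have [measurable]: "f \<in> borel_measurable M" "g \<in> borel_measurable M"
    and "integrable M (\<lambda>x. (norm (f x))\<^sup>2)" "integrable M (\<lambda>x. (norm (g x))\<^sup>2)"
    using assms by (auto simp: square_integrable_def)
  then have "integrable M (\<lambda>x. 2 * (norm (f x))\<^sup>2 + 2 * (norm (g x))\<^sup>2)" by auto
  then have "integrable M (\<lambda>x. (norm (f x + g x))\<^sup>2)"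
  proof (rule Bochner_Integration.integrable_bound)
    show "AE x in M. norm ((norm (f x + g x))\<^sup>2) \<le> norm (2 * (norm (f x))\<^sup>2 + 2 * (norm (g x))\<^sup>2)"
      using norm_add_squared_le[of 1 "f _" "g _"] by auto
  qed measurable
  then show ?thesis by (simp add: square_integrable_def)
qed

lemma square_integrable_uminus: "square_integrable M f \<Longrightarrow> square_integrable M (\<lambda>x. - f x)"
  by (auto simp: square_integrable_def)

lemma square_integrable_diff:
  "square_integrable M f \<Longrightarrow> square_integrable M g \<Longrightarrow> square_integrable M (\<lambda>x. f x - g x)"
  using square_integrable_add[of M f "\<lambda>x. - g x"] square_integrable_uminus[of M g] by simp

lemma square_integrable_integrable:
  fixes f :: "'a \<Rightarrow> real"
  assumes "finite_measure M" "square_integrable M f"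
  shows "integrable M f"
proof -
  interpret finite_measure M by fact
  have f: "f \<in> borel_measurable M" "integrable M (\<lambda>x. (f x)\<^sup>2)" using assms by (auto simp: square_integrable_def)
  then have "integrable M (\<lambda>x. 1 + (f x)\<^sup>2)" by auto
  then show ?thesis
  proof (rule Bochner_Integration.integrable_bound)
    have "\<bar>t\<bar> \<le> 1 + t\<^sup>2" for t :: real
      using zero_le_power2[of "\<bar>t\<bar> - 1"] by (simp add: power2_diff)
    then show "AE x in M. norm (f x) \<le> norm (1 + (f x)\<^sup>2)" by (auto simp: add_nonneg_nonneg)
  qed (use f in auto)
qed

lemma square_integrable_inner:
  assumes "square_integrable M G"
  shows "square_integrable M (\<lambda>x. G x \<bullet> c)"
proof -
  have [measurable]: "G \<in> borel_measurable M" and "integrable M (\<lambda>x. (norm (G x))\<^sup>2)"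
    using assms by (auto simp: square_integrable_def)
  then have "integrable M (\<lambda>x. (norm c)\<^sup>2 * (norm (G x))\<^sup>2)" by auto
  then have "integrable M (\<lambda>x. (G x \<bullet> c)\<^sup>2)"
  proof (rule Bochner_Integration.integrable_bound)
    have "(G x \<bullet> c)\<^sup>2 \<le> (norm c)\<^sup>2 * (norm (G x))\<^sup>2" for x
      using Cauchy_Schwarz_ineq[of "G x" c] by (simp add: power2_norm_eq_inner mult.commute)
    then show "AE x in M. norm ((G x \<bullet> c)\<^sup>2) \<le> norm ((norm c)\<^sup>2 * (norm (G x))\<^sup>2)" by auto
  qed measurable
  then show ?thesis by (simp add: square_integrable_def)
qed

lemma L2_norm_squared: "(L2_norm M f)\<^sup>2 = (\<integral>x. (norm (f x))\<^sup>2 \<partial>M)"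
  by (simp add: L2_norm_def)

lemma L2_norm_nonneg: "0 \<le> L2_norm M f"
  by (simp add: L2_norm_def)

lemma L2_norm_triangle:
  assumes "square_integrable M f" "square_integrable M g"
  shows "L2_norm M (\<lambda>x. f x + g x) \<le> L2_norm M f + L2_norm M g"
proof (rule field_le_epsilon)
  let ?A = "L2_norm M f" and ?B = "L2_norm M g"
  fix e :: real assume e: "e > 0"
  \<comment> \<open>The norms are enlarged a little so that the optimal \<open>\<epsilon> = B / A\<close> is defined and positive.\<close>
  define A B where "A = ?A + e / 2" and "B = ?B + e / 2"
  have AB: "0 < A" "0 < B" "?A \<le> A" "?B \<le> B"
    using e L2_norm_nonneg[of M f] L2_norm_nonneg[of M g] by (auto simp: A_def B_def)
  have i: "integrable M (\<lambda>x. (norm (f x))\<^sup>2)" "integrable M (\<lambda>x. (norm (g x))\<^sup>2)"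
      "integrable M (\<lambda>x. (norm (f x + g x))\<^sup>2)"
    using assms square_integrable_add[OF assms] by (auto simp: square_integrable_def)
  have "(L2_norm M (\<lambda>x. f x + g x))\<^sup>2 \<le> (\<integral>x. (1 + B / A) * (norm (f x))\<^sup>2 + (1 + 1 / (B / A)) * (norm (g x))\<^sup>2 \<partial>M)"
    unfolding L2_norm_squared using AB
    by (intro integral_mono norm_add_squared_le i Bochner_Integration.integrable_add integrable_mult_right) auto
  also have "\<dots> = (1 + B / A) * ?A\<^sup>2 + (1 + A / B) * ?B\<^sup>2"
    using i by (simp add: L2_norm_squared)
  also have "\<dots> \<le> (1 + B / A) * A\<^sup>2 + (1 + A / B) * B\<^sup>2"
    using AB L2_norm_nonneg[of M f] L2_norm_nonneg[of M g]
    by (intro add_mono mult_left_mono power_mono) auto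
  also have "\<dots> = (A + B)\<^sup>2"
  proof -
    have "(1 + B / A) * A\<^sup>2 = A\<^sup>2 + A * B" "(1 + A / B) * B\<^sup>2 = B\<^sup>2 + A * B"
      using AB by (auto simp: power2_eq_square distrib_right)
    then show ?thesis by (simp add: power2_sum)
  qed
  finally have "(L2_norm M (\<lambda>x. f x + g x))\<^sup>2 \<le> (A + B)\<^sup>2" .
  then have "L2_norm M (\<lambda>x. f x + g x) \<le> A + B"
    by (rule power2_le_imp_le) (use AB in simp)
  then show "L2_norm M (\<lambda>x. f x + g x) \<le> ?A + ?B + e" by (simp add: A_def B_def)
qed

lemma L2_norm_minus_commute: "L2_norm M (\<lambda>x. f x - g x) = L2_norm M (\<lambda>x. g x - f x)"
  by (simp add: L2_norm_def norm_minus_commute)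

lemma L2_norm_diff_abs_le:
  assumes "square_integrable M f" "square_integrable M g"
  shows "\<bar>L2_norm M f - L2_norm M g\<bar> \<le> L2_norm M (\<lambda>x. f x - g x)"
proof -
  have "L2_norm M f \<le> L2_norm M (\<lambda>x. f x - g x) + L2_norm M g"
    using L2_norm_triangle[OF square_integrable_diff[OF assms] assms(2)] by simp
  moreover have "L2_norm M g \<le> L2_norm M (\<lambda>x. g x - f x) + L2_norm M f"
    using L2_norm_triangle[OF square_integrable_diff[OF assms(2,1)] assms(1)] by simp
  ultimately show ?thesis unfolding L2_norm_minus_commute[of M g f] by linarith
qed

lemma L2_norm_tendsto:
  assumes "\<And>k. square_integrable M (f k)" "square_integrable M g"
    and "(\<lambda>k. L2_norm M (\<lambda>x. f k x - g x)) \<longlonglongrightarrow> 0"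
  shows "(\<lambda>k. L2_norm M (f k)) \<longlonglongrightarrow> L2_norm M g"
proof -
  have "(\<lambda>k. L2_norm M (f k) - L2_norm M g) \<longlonglongrightarrow> 0"
    by (rule Lim_null_comparison[OF _ assms(3)])
       (use L2_norm_diff_abs_le[OF assms(1,2)] in \<open>auto intro: always_eventually\<close>)
  then show ?thesis by (simp add: LIM_zero_iff)
qed

lemma L2_norm_cong_AE:
  assumes "f \<in> borel_measurable M" "g \<in> borel_measurable M" "AE x in M. f x = g x"
  shows "L2_norm M f = L2_norm M g"
proof -
  have "(\<integral>x. (norm (f x))\<^sup>2 \<partial>M) = (\<integral>x. (norm (g x))\<^sup>2 \<partial>M)"
    by (rule integral_cong_AE) (use assms in auto)
  then show ?thesis by (simp add: L2_norm_def)
qed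

text \<open>
  The Cauchy-Schwarz inequality against a constant: with \<open>m\<close> the total mass and \<open>I\<close> the integral of \<open>f\<close>,
  it is the nonnegativity of the integral of \<open>(m f - I)\<^sup>2\<close>.
\<close>
lemma integral_squared_le_L2_norm:
  fixes f :: "'a \<Rightarrow> real"
  assumes "finite_measure M" "square_integrable M f"
  shows "(\<integral>x. f x \<partial>M)\<^sup>2 \<le> measure M (space M) * (L2_norm M f)\<^sup>2"
proof -
  interpret finite_measure M by fact
  let ?m = "measure M (space M)" and ?I = "\<integral>x. f x \<partial>M"
  have i: "integrable M f" "integrable M (\<lambda>x. (f x)\<^sup>2)"
    using square_integrable_integrable[OF assms] assms(2) by (auto simp: square_integrable_def)
  have L2: "(L2_norm M f)\<^sup>2 = (\<integral>x. (f x)\<^sup>2 \<partial>M)" by (simp add: L2_norm_squared)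
  have "0 \<le> (\<integral>x. (?m * f x - ?I)\<^sup>2 \<partial>M)" by (intro integral_nonneg_AE) auto
  also have "\<dots> = (\<integral>x. ?m\<^sup>2 * (f x)\<^sup>2 - (2 * ?m * ?I) * f x + ?I\<^sup>2 \<partial>M)"
    by (simp add: power2_eq_square algebra_simps)
  also have "\<dots> = ?m\<^sup>2 * (\<integral>x. (f x)\<^sup>2 \<partial>M) - (2 * ?m * ?I) * ?I + ?m * ?I\<^sup>2"
    using i by simp
  also have "\<dots> = ?m * (?m * (L2_norm M f)\<^sup>2 - ?I\<^sup>2)"
    unfolding L2 by (simp add: power2_eq_square algebra_simps)
  finally have *: "0 \<le> ?m * (?m * (L2_norm M f)\<^sup>2 - ?I\<^sup>2)" .
  show ?thesis
  proof (cases "?m = 0")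
    case True
    then have "emeasure M (space M) = 0" by (simp add: emeasure_eq_measure)
    then have "AE x in M. f x = 0" by (intro AE_I[of _ _ "space M"]) auto
    then have "?I = 0" by (rule integral_eq_zero_AE)
    then show ?thesis using True by simp
  next
    case False
    then have "?m > 0" by (simp add: less_le)
    with * show ?thesis by (simp add: zero_le_mult_iff)
  qed
qed

section \<open>Weak gradients on boxes\<close>

definition gradient :: "('a::euclidean_space \<Rightarrow> real) \<Rightarrow> 'a \<Rightarrow> 'a" where
  "gradient f x = (\<Sum>b\<in>Basis. partial_deriv b f x *\<^sub>R b)"

lemma gradient_inner_Basis: "b \<in> Basis \<Longrightarrow> gradient f x \<bullet> b = partial_deriv b f x"
  by (simp add: gradient_def)

lemma continuous_gradient: "smooth f \<Longrightarrow> continuous_on UNIV (gradient f)"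
  unfolding gradient_def by (intro continuous_intros smooth_continuous smooth_partial_deriv)

lemma borel_measurable_lebesgue_on:
  "f \<in> borel_measurable borel \<Longrightarrow> f \<in> borel_measurable (lebesgue_on S)"
  by (intro measurable_restrict_space1 measurable_completion) simp

lemma finite_measure_lebesgue_on_box: "finite_measure (lebesgue_on (box l r))"
  by (rule finite_measure_lebesgue_on) (rule lmeasurable_box)

lemma integrable_mult_continuous:
  fixes g c :: "'a::euclidean_space \<Rightarrow> real"
  assumes g: "integrable (lebesgue_on (box l r)) g" and c: "continuous_on UNIV c"
  shows "integrable (lebesgue_on (box l r)) (\<lambda>x. g x * c x)"
proof -
  have "compact (c ` cbox l r)"
    by (intro compact_continuous_image continuous_on_subset[OF c]) auto
  then obtain K where K: "\<And>x. x \<in> cbox l r \<Longrightarrow> \<bar>c x\<bar> \<le> K"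
    by (force dest!: compact_imp_bounded simp: bounded_iff)
  have "integrable (lebesgue_on (box l r)) (\<lambda>x. K * g x)" using g by simp
  then show ?thesis
  proof (rule Bochner_Integration.integrable_bound)
    have "\<bar>g x * c x\<bar> \<le> \<bar>K * g x\<bar>" if "x \<in> box l r" for x
    proof -
      have "\<bar>c x\<bar> \<le> \<bar>K\<bar>" using K[of x] that box_subset_cbox[of l r] by force
      then have "\<bar>g x\<bar> * \<bar>c x\<bar> \<le> \<bar>g x\<bar> * \<bar>K\<bar>" by (rule mult_left_mono) simp
      then show ?thesis by (simp add: abs_mult mult.commute)
    qed
    then show "AE x in lebesgue_on (box l r). norm (g x * c x) \<le> norm (K * g x)"
      by (intro AE_I2) (auto simp: space_restrict_space)
    show "(\<lambda>x. g x * c x) \<in> borel_measurable (lebesgue_on (box l r))"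
      using g borel_measurable_lebesgue_on[OF borel_measurable_continuous_onI[OF c]] by (auto intro: borel_measurable_times)
  qed
qed

lemma continuous_integrable_box:
  fixes c :: "'a::euclidean_space \<Rightarrow> real"
  assumes "continuous_on UNIV c"
  shows "integrable (lebesgue_on (box l r)) c"
proof -
  interpret finite_measure "lebesgue_on (box l r)" by (rule finite_measure_lebesgue_on_box)
  show ?thesis using integrable_mult_continuous[of l r "\<lambda>_. 1", OF _ assms] by simp
qed

lemma continuous_square_integrable_box:
  fixes c :: "'a::euclidean_space \<Rightarrow> 'b::euclidean_space"
  assumes "continuous_on UNIV c"
  shows "square_integrable (lebesgue_on (box l r)) c"
  unfolding square_integrable_def
  by (intro conjI borel_measurable_lebesgue_on borel_measurable_continuous_onI assms
      continuous_integrable_box continuous_intros)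

lemma continuous_integral_box:
  fixes c :: "'a::euclidean_space \<Rightarrow> real"
  assumes "continuous_on UNIV c"
  shows "(\<integral>x. c x \<partial>lebesgue_on (box l r)) = integral (cbox l r) c"
  using lebesgue_integral_eq_integral[OF continuous_integrable_box[OF assms, of l r]]
  by (simp add: integral_open_interval)

text \<open>
  Boxes form an intersection-stable generator of the Borel sets, and the sets over which \<open>g\<close> integrates
  to zero are closed under complements, as the total integral is zero, and under disjoint unions. A Lebesgue set differs from a Borel set by
  a null set.
\<close>
lemma AE_zero_if_integrals_over_boxes_zero:
  fixes g :: "'a::euclidean_space \<Rightarrow> real"
  assumes g: "integrable lebesgue g"
    and boxes: "\<And>l r. (\<integral>x. indicator (box l r) x * g x \<partial>lebesgue) = 0"
    and total: "(\<integral>x. g x \<partial>lebesgue) = 0"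
  shows "AE x in lebesgue. g x = 0"
proof (rule density_unique_real)
  have si: "set_integrable lebesgue A g" if "A \<in> sets lebesgue" for A
    using integrable_mult_indicator[OF that g] by (simp add: set_integrable_def)
  have borel: "(LINT x:A|lebesgue. g x) = 0" if "A \<in> sets borel" for A
  proof -
    let ?E = "range (\<lambda>(a, b). box a b :: 'a set)"
    have sets: "sigma_sets UNIV ?E = sets borel" by (simp add: borel_eq_box)
    have "Int_stable ?E" by (auto simp: Int_stable_def box_Int_box)
    moreover have "?E \<subseteq> Pow UNIV" by simp
    moreover have "A \<in> sigma_sets UNIV ?E" using that sets by simp
    ultimately show ?thesis
    proof (induction rule: sigma_sets_induct_disjoint)
      case (basic A)
      then show ?case using boxes by (auto simp: set_lebesgue_integral_def)
    next
      case empty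
      show ?case by (simp add: set_lebesgue_integral_def)
    next
      case (compl A)
      then have A: "A \<in> sets lebesgue" unfolding sets by simp
      then have "(LINT x:A \<union> (UNIV - A)|lebesgue. g x) = (LINT x:A|lebesgue. g x) + (LINT x:UNIV - A|lebesgue. g x)"
        by (intro set_integral_Un si) (auto intro: sets.compl_sets[of _ lebesgue, simplified])
      then show ?case using compl.IH total by (simp add: set_lebesgue_integral_def)
    next
      case (union A)
      then have A: "A i \<in> sets lebesgue" for i unfolding sets by auto
      have "(LINT x:(\<Union>i. A i)|lebesgue. g x) = (\<Sum>i. (LINT x:(A i)|lebesgue. g x))"
        by (rule lebesgue_integral_countable_add)
           (use A union.hyps in \<open>auto simp: disjoint_family_on_def intro!: si\<close>)
      then show ?case using union.IH by simp
    qed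
  qed
  show "(LINT x:A|lebesgue. g x) = (LINT x:A|lebesgue. 0)" if Am: "A \<in> sets lebesgue" for A
  proof -
    obtain S N N' where A: "A = S \<union> N" "N \<subseteq> N'" "N' \<in> null_sets lborel" "S \<in> sets lborel"
      using sets_completionE[OF Am] by metis
    have "AE x in lebesgue. x \<notin> N'" using A(3) by (intro AE_not_in null_sets_completionI)
    then have "AE x in lebesgue. indicator A x *\<^sub>R g x = indicator S x *\<^sub>R g x"
      by eventually_elim (use A in \<open>auto split: split_indicator\<close>)
    then have "(LINT x:A|lebesgue. g x) = (LINT x:S|lebesgue. g x)"
      unfolding set_lebesgue_integral_def
      using si[OF Am] si[of S] A(4) by (intro integral_cong_AE) (auto simp: set_integrable_def)
    then show ?thesis using borel[of S] A(4) by (simp add: set_lebesgue_integral_def)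
  qed
qed (use g in auto)


text \<open>
  The fundamental lemma of the calculus of variations. By dominated convergence along the bumps, the
  integral of \<open>g\<close> over every box inside the domain vanishes.
\<close>
lemma AE_zero_if_orthogonal_to_test_functions:
  fixes g :: "'a::euclidean_space \<Rightarrow> real"
  assumes g: "integrable (lebesgue_on (box \<alpha> \<beta>)) g"
    and test: "\<And>\<phi>. test_function (box \<alpha> \<beta>) \<phi> \<Longrightarrow> (\<integral>x. g x * \<phi> x \<partial>lebesgue_on (box \<alpha> \<beta>)) = 0"
  shows "AE x in lebesgue_on (box \<alpha> \<beta>). g x = 0"
proof -
  let ?O = "box \<alpha> \<beta>"
  define G where "G = (\<lambda>x. indicator ?O x * g x)"
  have G: "integrable lebesgue G"
    using g by (simp add: integrable_restrict_space G_def)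
  have "(\<integral>x. indicator (box l r) x * G x \<partial>lebesgue) = 0" if sub: "box l r \<subseteq> ?O" for l r
  proof -
    have zero: "(\<integral>x. box_bump l r (Suc n) x * G x \<partial>lebesgue) = 0" for n
    proof -
      have "(\<integral>x. box_bump l r (Suc n) x * G x \<partial>lebesgue) = (\<integral>x. g x * box_bump l r (Suc n) x \<partial>lebesgue_on ?O)"
        by (simp add: integral_restrict_space G_def mult_ac)
      also have "\<dots> = 0"
        by (intro test test_function_mono[OF test_function_box_bump sub]) simp
      finally show ?thesis .
    qed
    have "(\<lambda>n. \<integral>x. box_bump l r (Suc n) x * G x \<partial>lebesgue) \<longlonglongrightarrow> (\<integral>x. indicator (box l r) x * G x \<partial>lebesgue)"
    proof (rule integral_dominated_convergence[where w="\<lambda>x. \<bar>G x\<bar>"])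
      have Gm: "G \<in> borel_measurable lebesgue" using G by (rule borel_measurable_integrable)
      show "(\<lambda>x. indicator (box l r) x * G x) \<in> borel_measurable lebesgue"
        by (intro borel_measurable_times borel_measurable_indicator Gm) simp
      have bm: "box_bump l r n \<in> borel_measurable lebesgue" for n
        by (intro measurable_completion)
           (simp add: borel_measurable_continuous_onI smooth_continuous smooth_box_bump)
      show "(\<lambda>x. box_bump l r (Suc n) x * G x) \<in> borel_measurable lebesgue" for n
        by (intro borel_measurable_times bm Gm)
      show "AE x in lebesgue. norm (box_bump l r (Suc n) x * G x) \<le> \<bar>G x\<bar>" for n
        using box_bump_bounds[of l r "Suc n"] by (auto simp: abs_mult intro!: mult_left_le_one_le)
      show "AE x in lebesgue. (\<lambda>n. box_bump l r (Suc n) x * G x) \<longlonglongrightarrow> indicator (box l r) x * G x"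
        by (intro AE_I2 tendsto_mult tendsto_const LIMSEQ_Suc[OF box_bump_tendsto])
    qed (use G in auto)
    then show ?thesis unfolding zero by (simp add: LIMSEQ_const_iff)
  qed
  note sub = this
  have "AE x in lebesgue. G x = 0"
  proof (rule AE_zero_if_integrals_over_boxes_zero[OF G])
    fix l r
    have "\<exists>l' r'. box l r \<inter> ?O = box l' r'" unfolding box_Int_box by blast
    then obtain l' r' where "box l r \<inter> ?O = box l' r'" by blast
    then have "box l' r' \<subseteq> ?O" and eq: "indicator (box l r) x * G x = indicator (box l' r') x * G x" for x
      by (auto simp: G_def split: split_indicator)
    from sub[OF this(1)] show "(\<integral>x. indicator (box l r) x * G x \<partial>lebesgue) = 0" by (simp add: eq)
  next
    have "indicator ?O x * G x = G x" for x by (simp add: G_def split: split_indicator)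
    with sub[of \<alpha> \<beta>] show "(\<integral>x. G x \<partial>lebesgue) = 0" by simp
  qed
  then show ?thesis by (auto simp: AE_restrict_space_iff G_def elim!: eventually_mono split: split_indicator)
qed

lemma test_function_continuous: "test_function \<Omega> \<phi> \<Longrightarrow> continuous_on UNIV \<phi>"
  by (simp add: test_function_def smooth_continuous)

lemma test_function_partial_deriv_continuous:
  "test_function \<Omega> \<phi> \<Longrightarrow> b \<in> Basis \<Longrightarrow> continuous_on UNIV (partial_deriv b \<phi>)"
  by (simp add: test_function_def smooth_continuous smooth_partial_deriv)

lemma weak_gradient_integrable:
  assumes "has_weak_gradient (box \<alpha> \<beta>) w G"
  shows "integrable (lebesgue_on (box \<alpha> \<beta>)) (\<lambda>x. G x \<bullet> b)"
  using assms
  by (intro square_integrable_integrable finite_measure_lebesgue_on_box square_integrable_inner)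
     (simp add: has_weak_gradient_def)

lemma weak_gradient_unique:
  assumes G: "has_weak_gradient (box \<alpha> \<beta>) w G" and H: "has_weak_gradient (box \<alpha> \<beta>) w H"
  shows "AE x in lebesgue_on (box \<alpha> \<beta>). G x = H x"
proof -
  let ?M = "lebesgue_on (box \<alpha> \<beta>)"
  have "AE x in ?M. G x \<bullet> b - H x \<bullet> b = 0" if b: "b \<in> Basis" for b
  proof (rule AE_zero_if_orthogonal_to_test_functions)
    show "integrable ?M (\<lambda>x. G x \<bullet> b - H x \<bullet> b)"
      by (intro Bochner_Integration.integrable_diff weak_gradient_integrable[OF G] weak_gradient_integrable[OF H])
    fix \<phi> assume t: "test_function (box \<alpha> \<beta>) \<phi>"
    have "(\<integral>x. (G x \<bullet> b) * \<phi> x \<partial>?M) = (\<integral>x. (H x \<bullet> b) * \<phi> x \<partial>?M)"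
      using G H t b by (simp add: has_weak_gradient_def)
    moreover have "(\<integral>x. (G x \<bullet> b - H x \<bullet> b) * \<phi> x \<partial>?M) = (\<integral>x. (G x \<bullet> b) * \<phi> x \<partial>?M) - (\<integral>x. (H x \<bullet> b) * \<phi> x \<partial>?M)"
      unfolding left_diff_distrib
      by (intro Bochner_Integration.integral_diff integrable_mult_continuous weak_gradient_integrable[OF G]
          weak_gradient_integrable[OF H] test_function_continuous[OF t])
    ultimately show "(\<integral>x. (G x \<bullet> b - H x \<bullet> b) * \<phi> x \<partial>?M) = 0" by simp
  qed
  then have "AE x in ?M. \<forall>b\<in>Basis. G x \<bullet> b - H x \<bullet> b = 0"
    by (intro AE_finite_allI) auto
  then show ?thesis
    by eventually_elim (simp add: euclidean_eq_iff[of "G _"])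
qed

lemma has_weak_gradient_diff:
  assumes v: "square_integrable (lebesgue_on (box \<alpha> \<beta>)) v" and G: "has_weak_gradient (box \<alpha> \<beta>) v G"
    and w: "square_integrable (lebesgue_on (box \<alpha> \<beta>)) w" and H: "has_weak_gradient (box \<alpha> \<beta>) w H"
  shows "has_weak_gradient (box \<alpha> \<beta>) (\<lambda>x. v x - w x) (\<lambda>x. G x - H x)"
  unfolding has_weak_gradient_def
proof (intro conjI allI impI ballI)
  let ?M = "lebesgue_on (box \<alpha> \<beta>)"
  show "square_integrable ?M (\<lambda>x. G x - H x)"
    by (rule square_integrable_diff) (use G H in \<open>simp_all add: has_weak_gradient_def\<close>)
  fix \<phi> b assume t: "test_function (box \<alpha> \<beta>) \<phi>" and b: "b \<in> (Basis :: 'a set)"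
  note i = square_integrable_integrable[OF finite_measure_lebesgue_on_box]
  have "(\<integral>x. (v x - w x) * partial_deriv b \<phi> x \<partial>?M) = (\<integral>x. v x * partial_deriv b \<phi> x \<partial>?M) - (\<integral>x. w x * partial_deriv b \<phi> x \<partial>?M)"
    unfolding left_diff_distrib
    by (intro Bochner_Integration.integral_diff integrable_mult_continuous i[OF v] i[OF w]
        test_function_partial_deriv_continuous[OF t b])
  also have "\<dots> = - ((\<integral>x. (G x \<bullet> b) * \<phi> x \<partial>?M) - (\<integral>x. (H x \<bullet> b) * \<phi> x \<partial>?M))"
    using G H t b by (simp add: has_weak_gradient_def)
  also have "(\<integral>x. (G x \<bullet> b) * \<phi> x \<partial>?M) - (\<integral>x. (H x \<bullet> b) * \<phi> x \<partial>?M) = (\<integral>x. ((G x - H x) \<bullet> b) * \<phi> x \<partial>?M)"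
    unfolding inner_diff_left left_diff_distrib
    by (intro Bochner_Integration.integral_diff[symmetric] integrable_mult_continuous weak_gradient_integrable[OF G]
          weak_gradient_integrable[OF H] test_function_continuous[OF t])
  finally show "(\<integral>x. (v x - w x) * partial_deriv b \<phi> x \<partial>?M) = - (\<integral>x. ((G x - H x) \<bullet> b) * \<phi> x \<partial>?M)" .
qed

lemma H1_has_weak_gradient: "w \<in> H1 \<Omega> \<Longrightarrow> has_weak_gradient \<Omega> w (weak_gradient \<Omega> w)"
  unfolding H1_def weak_gradient_def using someI_ex[of "has_weak_gradient \<Omega> w"] by blast

lemma L2_norm_weak_gradient:
  assumes G: "has_weak_gradient (box \<alpha> \<beta>) w G"
  shows "L2_norm (lebesgue_on (box \<alpha> \<beta>)) (weak_gradient (box \<alpha> \<beta>) w) = L2_norm (lebesgue_on (box \<alpha> \<beta>)) G"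
proof -
  have H: "has_weak_gradient (box \<alpha> \<beta>) w (weak_gradient (box \<alpha> \<beta>) w)"
    unfolding weak_gradient_def by (rule someI[of "has_weak_gradient (box \<alpha> \<beta>) w", OF G])
  show ?thesis
    by (rule L2_norm_cong_AE[OF _ _ weak_gradient_unique[OF H G]])
       (use G H in \<open>auto simp: has_weak_gradient_def square_integrable_def\<close>)
qed

lemma has_real_derivative_partial_deriv:
  fixes f :: "real \<times> real \<Rightarrow> real"
  assumes "smooth f"
  shows "((\<lambda>x. f (x, y)) has_real_derivative partial_deriv (1, 0) f (x, y)) (at x)"
    and "((\<lambda>y. f (x, y)) has_real_derivative partial_deriv (0, 1) f (x, y)) (at y)"
proof -
  have d: "(f has_derivative (\<lambda>h. partial_deriv h f z)) (at z)" for z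
    by (intro has_derivative_partial_deriv smooth_differentiable assms)
  have scale: "partial_deriv (r *\<^sub>R v) f z = r * partial_deriv v f z" for r v z
    using linear_cmul[OF bounded_linear.linear[OF has_derivative_bounded_linear[OF d[of z]]], of r v] by simp
  have "((\<lambda>x. f (x, y)) has_derivative (\<lambda>h. partial_deriv (h, 0) f (x, y))) (at x)"
    by (rule has_derivative_compose[OF _ d]) (auto intro!: derivative_eq_intros)
  moreover have "(\<lambda>h. partial_deriv (h, 0) f (x, y)) = (*) (partial_deriv (1, 0) f (x, y))"
  proof
    show "partial_deriv (h, 0) f (x, y) = partial_deriv (1, 0) f (x, y) * h" for h
      using scale[of h "(1, 0)" "(x, y)"] by simp
  qed
  ultimately show "((\<lambda>x. f (x, y)) has_real_derivative partial_deriv (1, 0) f (x, y)) (at x)"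
    by (simp only: has_field_derivative_def)
  have "((\<lambda>y. f (x, y)) has_derivative (\<lambda>h. partial_deriv (0, h) f (x, y))) (at y)"
    by (rule has_derivative_compose[OF _ d]) (auto intro!: derivative_eq_intros)
  moreover have "(\<lambda>h. partial_deriv (0, h) f (x, y)) = (*) (partial_deriv (0, 1) f (x, y))"
  proof
    show "partial_deriv (0, h) f (x, y) = partial_deriv (0, 1) f (x, y) * h" for h
      using scale[of h "(0, 1)" "(x, y)"] by simp
  qed
  ultimately show "((\<lambda>y. f (x, y)) has_real_derivative partial_deriv (0, 1) f (x, y)) (at y)"
    by (simp only: has_field_derivative_def)
qed

lemma Basis_real_prod: "(Basis :: (real \<times> real) set) = {(1, 0), (0, 1)}"
  by (auto simp: Basis_prod_def)

text \<open>
  Integrating first in the direction of differentiation leaves differences of boundary values, and these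
  are zero.
\<close>
lemma integral_partial_deriv_zero:
  fixes F :: "real \<times> real \<Rightarrow> real"
  assumes F: "smooth F" and zero: "\<And>z. z \<notin> box (a, c) (b, d) \<Longrightarrow> F z = 0"
    and v: "v \<in> Basis" and le: "a \<le> b" "c \<le> d"
  shows "integral (cbox (a, c) (b, d)) (partial_deriv v F) = 0"
proof -
  have cont: "continuous_on S (partial_deriv v F)" for S
    using smooth_continuous[OF smooth_partial_deriv[OF F v]] continuous_on_subset by blast
  have out: "F (x, y) = 0" if "x = a \<or> x = b \<or> y = c \<or> y = d" for x y
    by (rule zero) (use that in \<open>auto simp: mem_box Basis_real_prod\<close>)
  consider "v = (1, 0)" | "v = (0, 1)" using v by (auto simp: Basis_real_prod)
  then show ?thesis
  proof cases
    case 1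
    have "integral {a..b} (\<lambda>x. partial_deriv v F (x, y)) = 0" for y
      using fundamental_theorem_of_calculus[OF le(1), of "\<lambda>x. F (x, y)" "\<lambda>x. partial_deriv v F (x, y)"]
        has_real_derivative_partial_deriv(1)[OF F] out 1
      by (auto simp: has_real_derivative_iff_has_vector_derivative has_vector_derivative_at_within dest!: integral_unique)
    then show ?thesis by (simp add: integral_cbox_iterated(2)[OF cont])
  next
    case 2
    have "integral {c..d} (\<lambda>y. partial_deriv v F (x, y)) = 0" for x
      using fundamental_theorem_of_calculus[OF le(2), of "\<lambda>y. F (x, y)" "\<lambda>y. partial_deriv v F (x, y)"]
        has_real_derivative_partial_deriv(2)[OF F] out 2
      by (auto simp: has_real_derivative_iff_has_vector_derivative has_vector_derivative_at_within dest!: integral_unique)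
    then show ?thesis by (simp add: integral_cbox_iterated(1)[OF cont])
  qed
qed

text \<open>
  Integration by parts: the product of \<open>f\<close> with a test function vanishes on the boundary.
\<close>
lemma has_weak_gradient_smooth:
  fixes f :: "real \<times> real \<Rightarrow> real"
  assumes f: "smooth f" and le: "a \<le> b" "c \<le> d"
  shows "has_weak_gradient (box (a, c) (b, d)) f (gradient f)"
  unfolding has_weak_gradient_def
proof (intro conjI allI impI ballI)
  let ?O = "box (a, c) (b, d)"
  show "square_integrable (lebesgue_on ?O) (gradient f)"
    by (intro continuous_square_integrable_box continuous_gradient f)
  fix \<phi> v assume t: "test_function ?O \<phi>" and v: "v \<in> (Basis :: (real \<times> real) set)"
  have \<phi>: "smooth \<phi>" and supp: "closure {x. \<phi> x \<noteq> 0} \<subseteq> ?O" using t by (auto simp: test_function_def)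
  have cont [continuous_intros]: "continuous_on UNIV f" "continuous_on UNIV \<phi>"
    "continuous_on UNIV (partial_deriv v f)" "continuous_on UNIV (partial_deriv v \<phi>)"
    by (intro smooth_continuous smooth_partial_deriv f \<phi> v)+
  have "integral (cbox (a, c) (b, d)) (partial_deriv v (\<lambda>x. f x * \<phi> x)) = 0"
  proof (rule integral_partial_deriv_zero[OF smooth_mult[OF f \<phi>] _ v le])
    show "f z * \<phi> z = 0" if "z \<notin> ?O" for z
      using that supp closure_subset[of "{x. \<phi> x \<noteq> 0}"] by auto
  qed
  moreover have "partial_deriv v (\<lambda>x. f x * \<phi> x) = (\<lambda>x. f x * partial_deriv v \<phi> x + partial_deriv v f x * \<phi> x)"
    by (intro ext partial_deriv_mult smooth_differentiable f \<phi>)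
  ultimately have "(\<integral>x. f x * partial_deriv v \<phi> x + partial_deriv v f x * \<phi> x \<partial>lebesgue_on ?O) = 0"
    by (subst continuous_integral_box) (auto intro!: continuous_intros)
  moreover have "(\<integral>x. f x * partial_deriv v \<phi> x + partial_deriv v f x * \<phi> x \<partial>lebesgue_on ?O)
    = (\<integral>x. f x * partial_deriv v \<phi> x \<partial>lebesgue_on ?O) + (\<integral>x. partial_deriv v f x * \<phi> x \<partial>lebesgue_on ?O)"
    by (intro Bochner_Integration.integral_add continuous_integrable_box continuous_intros)
  ultimately show "(\<integral>x. f x * partial_deriv v \<phi> x \<partial>lebesgue_on ?O) = - (\<integral>x. (gradient f x \<bullet> v) * \<phi> x \<partial>lebesgue_on ?O)"
    using v by (simp add: gradient_inner_Basis)
qed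

section \<open>The Poincare inequality on \<open>H\<^sup>1\<close> of a rectangle\<close>

lemma norm_gradient_squared:
  fixes f :: "real \<times> real \<Rightarrow> real"
  shows "(norm (gradient f z))\<^sup>2 = (partial_deriv (1, 0) f z)\<^sup>2 + (partial_deriv (0, 1) f z)\<^sup>2"
  by (simp add: gradient_def Basis_real_prod norm_Pair)

context
  fixes a b :: real
  assumes ab: "a > 0" "b > 0"
begin

abbreviation "rectangle \<equiv> box (-a, -b) (a, b)"

lemma L2_norm_rectangle:
  assumes "smooth f"
  shows "(L2_norm (lebesgue_on rectangle) f)\<^sup>2 = integral (cbox (-a, -b) (a, b)) (\<lambda>z. (f z)\<^sup>2)"
    and "(L2_norm (lebesgue_on rectangle) (gradient f))\<^sup>2 =
      integral (cbox (-a, -b) (a, b)) (\<lambda>z. (partial_deriv (1, 0) f z)\<^sup>2 + (partial_deriv (0, 1) f z)\<^sup>2)"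
proof -
  have "continuous_on UNIV f" using smooth_continuous[OF assms] .
  then show "(L2_norm (lebesgue_on rectangle) f)\<^sup>2 = integral (cbox (-a, -b) (a, b)) (\<lambda>z. (f z)\<^sup>2)"
    unfolding L2_norm_squared by (subst continuous_integral_box) (auto intro!: continuous_intros)
  have "continuous_on UNIV (\<lambda>z. (norm (gradient f z))\<^sup>2)"
    by (intro continuous_intros continuous_gradient assms)
  then show "(L2_norm (lebesgue_on rectangle) (gradient f))\<^sup>2 =
      integral (cbox (-a, -b) (a, b)) (\<lambda>z. (partial_deriv (1, 0) f z)\<^sup>2 + (partial_deriv (0, 1) f z)\<^sup>2)"
    unfolding L2_norm_squared by (simp add: continuous_integral_box norm_gradient_squared)
qed

lemma smooth_in_H1_rectangle: "smooth f \<Longrightarrow> f \<in> H1 rectangle"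
  unfolding H1_def
  using has_weak_gradient_smooth[of f "-a" a "-b" b] ab
  by (auto intro: continuous_square_integrable_box smooth_continuous)

lemma poincare_smooth_rectangle:
  assumes f: "smooth f" and k: "0 \<le> k" "k * (2 * a) \<le> pi" "k * (2 * b) \<le> pi"
  shows "k\<^sup>2 * (L2_norm (lebesgue_on rectangle) f)\<^sup>2 \<le> (L2_norm (lebesgue_on rectangle) (gradient f))\<^sup>2
     + k\<^sup>2 * (\<integral>x. f x \<partial>surface_measure (frontier rectangle))\<^sup>2 / 8"
proof -
  have "(\<integral>x. f x \<partial>surface_measure (frontier rectangle)) = edge_integral a b f"
    using has_boundary_integral_rectangle[OF ab smooth_continuous[OF f]] by (simp add: has_bochner_integral_iff)
  moreover have "continuous_on UNIV (partial_deriv (1, 0) f)" "continuous_on UNIV (partial_deriv (0, 1) f)"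
    by (intro smooth_continuous smooth_partial_deriv f, simp add: Basis_real_prod)+
  note poincare_rectangle_classical[OF ab k has_real_derivative_partial_deriv[OF f] smooth_continuous[OF f] this]
  ultimately show ?thesis
    unfolding L2_norm_rectangle[OF f] by simp
qed

text \<open>
  Every term of the inequality for smooth functions converges along the sequence that defines the trace.
  The boundary term tends to zero because the boundary integrals converge to that of the trace \<open>g\<close>, which
  is zero as the boundary has finite positive length.
\<close>
lemma poincare_bound_rectangle:
  assumes k: "0 < k" "k * (2 * a) \<le> pi" "k * (2 * b) \<le> pi"
  shows "poincare_bound rectangle (frontier rectangle) (1 / k)"
  unfolding poincare_bound_def
proof
  fix w assume "w \<in> H1_mean_zero rectangle (frontier rectangle)"
  then obtain g where w: "w \<in> H1 rectangle" and tr: "has_trace rectangle w g"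
    and mean: "boundary_mean (frontier rectangle) g = 0"
    by (auto simp: H1_mean_zero_def)
  let ?M = "lebesgue_on rectangle" and ?S = "surface_measure (frontier rectangle)"
  from tr obtain \<phi> where g: "square_integrable ?S g"
    and \<phi>: "\<And>k. smooth (\<phi> k)" "\<And>k. square_integrable ?S (\<phi> k)"
    and lim: "(\<lambda>k. H1_norm rectangle (\<lambda>x. \<phi> k x - w x)) \<longlonglongrightarrow> 0"
      "(\<lambda>k. L2_norm ?S (\<lambda>x. \<phi> k x - g x)) \<longlonglongrightarrow> 0"
    unfolding has_trace_def by blast
  define G where "G = weak_gradient rectangle w"
  have wG: "has_weak_gradient rectangle w G" unfolding G_def by (rule H1_has_weak_gradient[OF w])
  have sw: "square_integrable ?M w" "square_integrable ?M G"
    using w wG by (auto simp: H1_def has_weak_gradient_def)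
  have s\<phi>: "square_integrable ?M (\<phi> k)" "square_integrable ?M (gradient (\<phi> k))" for k
    by (intro continuous_square_integrable_box smooth_continuous continuous_gradient \<phi>)+
  have "has_weak_gradient rectangle (\<lambda>x. \<phi> k x - w x) (\<lambda>x. gradient (\<phi> k) x - G x)" for k
    using ab by (intro has_weak_gradient_diff s\<phi> sw wG has_weak_gradient_smooth \<phi>) auto
  note wd = L2_norm_weak_gradient[OF this]
  have le: "L2_norm ?M (\<lambda>x. \<phi> k x - w x) \<le> H1_norm rectangle (\<lambda>x. \<phi> k x - w x)"
    "L2_norm ?M (\<lambda>x. gradient (\<phi> k) x - G x) \<le> H1_norm rectangle (\<lambda>x. \<phi> k x - w x)" for k
    unfolding H1_norm_def wd by (intro real_le_rsqrt; simp)+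
  have "(\<lambda>k. L2_norm ?M (\<lambda>x. \<phi> k x - w x)) \<longlonglongrightarrow> 0" "(\<lambda>k. L2_norm ?M (\<lambda>x. gradient (\<phi> k) x - G x)) \<longlonglongrightarrow> 0"
    by (rule Lim_null_comparison[OF _ lim(1)], intro always_eventually allI, simp add: le L2_norm_nonneg)+
  note N = this
  have L: "(\<lambda>k. L2_norm ?M (\<phi> k)) \<longlonglongrightarrow> L2_norm ?M w" "(\<lambda>k. L2_norm ?M (gradient (\<phi> k))) \<longlonglongrightarrow> L2_norm ?M G"
    by (rule L2_norm_tendsto[OF s\<phi>(1) sw(1) N(1)], rule L2_norm_tendsto[OF s\<phi>(2) sw(2) N(2)])
  have fin: "finite_measure ?S" by (rule finite_measure_boundary_rectangle[OF ab])
  have "(\<integral>x. g x \<partial>?S) = 0"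
    using mean measure_boundary_rectangle[OF ab] ab by (auto simp: boundary_mean_def)
  then have diff: "(\<integral>x. \<phi> k x - g x \<partial>?S) = (\<integral>x. \<phi> k x \<partial>?S)" for k
    using square_integrable_integrable[OF fin g] square_integrable_integrable[OF fin \<phi>(2)] by simp
  have I: "(\<lambda>k. (\<integral>x. \<phi> k x \<partial>?S)\<^sup>2) \<longlonglongrightarrow> 0"
  proof (rule Lim_null_comparison)
    show "\<forall>\<^sub>F k in sequentially. norm ((\<integral>x. \<phi> k x \<partial>?S)\<^sup>2) \<le> measure ?S (space ?S) * (L2_norm ?S (\<lambda>x. \<phi> k x - g x))\<^sup>2"
      using integral_squared_le_L2_norm[OF fin square_integrable_diff[OF \<phi>(2) g]]
      by (intro always_eventually allI) (simp add: diff)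
    show "(\<lambda>k. measure ?S (space ?S) * (L2_norm ?S (\<lambda>x. \<phi> k x - g x))\<^sup>2) \<longlonglongrightarrow> 0"
      using tendsto_mult[OF tendsto_const tendsto_power[OF lim(2), of 2]] by simp
  qed
  have "k\<^sup>2 * (L2_norm ?M w)\<^sup>2 \<le> (L2_norm ?M G)\<^sup>2 + k\<^sup>2 * 0 / 8"
  proof (rule LIMSEQ_le)
    show "(\<lambda>n. k\<^sup>2 * (L2_norm ?M (\<phi> n))\<^sup>2) \<longlonglongrightarrow> k\<^sup>2 * (L2_norm ?M w)\<^sup>2"
      by (intro tendsto_intros L)
    show "(\<lambda>n. (L2_norm ?M (gradient (\<phi> n)))\<^sup>2 + k\<^sup>2 * (\<integral>x. \<phi> n x \<partial>?S)\<^sup>2 / 8) \<longlonglongrightarrow> (L2_norm ?M G)\<^sup>2 + k\<^sup>2 * 0 / 8"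
      by (intro tendsto_intros L I) simp
    show "\<exists>N. \<forall>n\<ge>N. k\<^sup>2 * (L2_norm ?M (\<phi> n))\<^sup>2 \<le> (L2_norm ?M (gradient (\<phi> n)))\<^sup>2 + k\<^sup>2 * (\<integral>x. \<phi> n x \<partial>?S)\<^sup>2 / 8"
      using poincare_smooth_rectangle[OF \<phi>(1)] k by auto
  qed
  then have "(k * L2_norm ?M w)\<^sup>2 \<le> (L2_norm ?M G)\<^sup>2" by (simp add: power_mult_distrib)
  then have "k * L2_norm ?M w \<le> L2_norm ?M G" by (rule power2_le_imp_le) (rule L2_norm_nonneg)
  then show "L2_norm ?M w \<le> 1 / k * L2_norm ?M (weak_gradient rectangle w)"
    using k by (simp add: G_def[symmetric] field_simps)
qed

text \<open>
  Smooth functions with vanishing boundary integral are their own traces, so an admissible constant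
  bounds them in terms of the classical gradient.
\<close>
lemma poincare_bound_smooth:
  assumes C: "poincare_bound rectangle (frontier rectangle) C"
    and f: "smooth f" and mean: "edge_integral a b f = 0"
  shows "L2_norm (lebesgue_on rectangle) f \<le> C * L2_norm (lebesgue_on rectangle) (gradient f)"
proof -
  let ?M = "lebesgue_on rectangle" and ?S = "surface_measure (frontier rectangle)"
  have cf: "continuous_on UNIV f" by (rule smooth_continuous[OF f])
  have "integrable ?S (\<lambda>x. (f x)\<^sup>2)" and fi: "has_bochner_integral ?S f 0"
    using has_boundary_integral_rectangle[OF ab, of "\<lambda>x. (f x)\<^sup>2"] has_boundary_integral_rectangle[OF ab cf] mean
    by (auto simp: has_bochner_integral_iff intro!: continuous_intros cf)
  then have sS: "square_integrable ?S f"
    by (auto simp: square_integrable_def has_bochner_integral_iff)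
  have wf: "has_weak_gradient rectangle f (gradient f)"
    using ab by (intro has_weak_gradient_smooth f) auto
  have sf: "square_integrable ?M f" by (intro continuous_square_integrable_box cf)
  have "L2_norm ?M (weak_gradient rectangle (\<lambda>x. f x - f x)) = L2_norm ?M (\<lambda>x. gradient f x - gradient f x)"
    by (rule L2_norm_weak_gradient[OF has_weak_gradient_diff[OF sf wf sf wf]])
  then have "H1_norm rectangle (\<lambda>x. f x - f x) = 0" by (simp add: H1_norm_def L2_norm_def)
  then have "has_trace rectangle f f"
    unfolding has_trace_def using smooth_in_H1_rectangle[OF f] f sS
    by (intro conjI exI[of _ "\<lambda>_. f"]) (auto simp: L2_norm_def)
  moreover have "boundary_mean (frontier rectangle) f = 0"
    using fi by (simp add: boundary_mean_def has_bochner_integral_iff)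
  ultimately have "f \<in> H1_mean_zero rectangle (frontier rectangle)"
    using smooth_in_H1_rectangle[OF f] by (auto simp: H1_mean_zero_def)
  then show ?thesis
    using C L2_norm_weak_gradient[OF wf] by (auto simp: poincare_bound_def)
qed

end

section \<open>Sharpness\<close>

lemma integral_sin_cos_squared:
  fixes a k :: real
  assumes "a > 0" "k * (2 * a) = pi"
  shows "integral {-a..a} (\<lambda>x. (sin (k * x))\<^sup>2) = a"
    and "integral {-a..a} (\<lambda>x. (cos (k * x))\<^sup>2) = a"
    and "integral {-a..a} (\<lambda>x. sin (k * x)) = 0"
proof -
  have k: "k \<noteq> 0" "k * a = pi / 2" using assms by auto
  have e: "sin (k * a) = 1" "cos (k * a) = 0" unfolding k(2) by auto
  have "((\<lambda>x. (sin (k * x))\<^sup>2) has_integral (a / 2 - sin (k * a) * cos (k * a) / (2 * k) - (- a / 2 - sin (k * - a) * cos (k * - a) / (2 * k)))) {-a..a}"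
  proof (rule fundamental_theorem_of_calculus)
    fix x
    have "((\<lambda>x. x / 2 - sin (k * x) * cos (k * x) / (2 * k)) has_real_derivative
        1 / 2 - k * (cos (k * x) * cos (k * x) - sin (k * x) * sin (k * x)) / (2 * k)) (at x)"
      by (rule derivative_eq_intros refl | use k(1) in \<open>simp add: field_simps\<close>)+
    moreover have "1 / 2 - k * (cos (k * x) * cos (k * x) - sin (k * x) * sin (k * x)) / (2 * k) = (sin (k * x))\<^sup>2"
    proof -
      have "cos (k * x) * cos (k * x) = 1 - sin (k * x) * sin (k * x)"
        using cos_squared_eq[of "k * x"] by (simp add: power2_eq_square)
      then show ?thesis using k(1) by (simp add: power2_eq_square diff_divide_distrib)
    qed
    ultimately have "((\<lambda>x. x / 2 - sin (k * x) * cos (k * x) / (2 * k)) has_real_derivative (sin (k * x))\<^sup>2) (at x)"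
      by simp
    then show "((\<lambda>x. x / 2 - sin (k * x) * cos (k * x) / (2 * k)) has_vector_derivative (sin (k * x))\<^sup>2) (at x within {-a..a})"
      by (simp add: has_real_derivative_iff_has_vector_derivative has_vector_derivative_at_within)
  qed (use assms in auto)
  then show s: "integral {-a..a} (\<lambda>x. (sin (k * x))\<^sup>2) = a"
    using e by (auto dest!: integral_unique)
  have "integral {-a..a} (\<lambda>x. (cos (k * x))\<^sup>2) = integral {-a..a} (\<lambda>x. 1 - (sin (k * x))\<^sup>2)"
    by (simp add: cos_squared_eq)
  also have "\<dots> = integral {-a..a} (\<lambda>x. 1) - integral {-a..a} (\<lambda>x. (sin (k * x))\<^sup>2)"
    by (intro integral_diff integrable_continuous_real continuous_intros)
  finally show "integral {-a..a} (\<lambda>x. (cos (k * x))\<^sup>2) = a" using s assms by simp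
  have "((\<lambda>x. sin (k * x)) has_integral (- cos (k * a) / k - (- cos (k * - a) / k))) {-a..a}"
  proof (rule fundamental_theorem_of_calculus)
    fix x
    have "((\<lambda>x. - cos (k * x) / k) has_real_derivative sin (k * x)) (at x)"
      using k by (auto intro!: derivative_eq_intros)
    then show "((\<lambda>x. - cos (k * x) / k) has_vector_derivative sin (k * x)) (at x within {-a..a})"
      by (simp add: has_real_derivative_iff_has_vector_derivative has_vector_derivative_at_within)
  qed (use assms in auto)
  then show "integral {-a..a} (\<lambda>x. sin (k * x)) = 0" by (auto dest!: integral_unique)
qed

lemma smooth_sin_ridge: "smooth (\<lambda>z. sin (v \<bullet> z))"
proof -
  define F where "F = (\<lambda>n t. sin (t + real n * (pi / 2)))"
  have "smooth (\<lambda>z. F 0 (v \<bullet> z + 0))"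
  proof (rule smooth_ridge[where F=F])
    fix n t
    have "sin (t + real (Suc n) * (pi / 2)) = cos (t + real n * (pi / 2))"
      using sin_add[of "t + real n * (pi / 2)" "pi / 2"] by (simp add: algebra_simps add_divide_distrib)
    then show "(F n has_real_derivative F (Suc n) t) (at t)"
      unfolding F_def by (auto intro!: derivative_eq_intros)
  qed
  then show ?thesis by (simp add: F_def)
qed

lemma partial_deriv_sin_ridge: "partial_deriv b (\<lambda>z. sin (v \<bullet> z)) z = (v \<bullet> b) * cos (v \<bullet> z)"
  by (rule partial_deriv_eqI) (auto intro!: derivative_eq_intros)

text \<open>
  The functions \<open>sin (\<pi>x/(2a))\<close> and \<open>sin (\<pi>y/(2b))\<close> vary in one variable only, and the sine and the cosine
  have the same mean square over the side, so the norms have ratio \<open>2a/\<pi>\<close> and \<open>2b/\<pi>\<close>.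
\<close>
lemma poincare_bound_lower:
  assumes ab: "a > 0" "b > 0" and C: "poincare_bound (box (-a, -b) (a, b)) (frontier (box (-a, -b) (a, b))) C"
  shows "2 * a / pi \<le> C" and "2 * b / pi \<le> C"
proof -
  let ?M = "lebesgue_on (box (-a, -b) (a, b))"
  have key: "1 / k \<le> C" if "k > 0" "smooth f" "edge_integral a b f = 0"
    "integral (cbox (-a, -b) (a, b)) (\<lambda>z. (f z)\<^sup>2) = 2 * a * b"
    "integral (cbox (-a, -b) (a, b)) (\<lambda>z. (partial_deriv (1, 0) f z)\<^sup>2 + (partial_deriv (0, 1) f z)\<^sup>2) = k\<^sup>2 * (2 * a * b)"
    for k and f :: "real \<times> real \<Rightarrow> real"
  proof -
    have "L2_norm ?M f = sqrt (2 * a * b)"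
      using L2_norm_rectangle(1)[OF ab that(2)] that(4) L2_norm_nonneg[of ?M f] by (metis real_sqrt_unique)
    moreover have "L2_norm ?M (gradient f) = k * sqrt (2 * a * b)"
      using L2_norm_rectangle(2)[OF ab that(2)] that(5) L2_norm_nonneg[of ?M "gradient f"] that(1)
      by (metis real_sqrt_unique real_sqrt_mult real_sqrt_abs abs_of_pos)
    ultimately have "1 * sqrt (2 * a * b) \<le> C * k * sqrt (2 * a * b)"
      using poincare_bound_smooth[OF ab C that(2,3)] by simp
    then have "1 \<le> C * k" using ab by (subst (asm) mult_le_cancel_right_pos) auto
    then show ?thesis using that(1) by (simp add: field_simps)
  qed
  have "1 / (pi / (2 * a)) \<le> C"
  proof (rule key)
    let ?k = "pi / (2 * a)" and ?f = "\<lambda>z :: real \<times> real. sin ((pi / (2 * a), 0) \<bullet> z)"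
    have k: "?k * (2 * a) = pi" using ab by simp
    note I = integral_sin_cos_squared[OF ab(1) k]
    have J: "integral {-a..a} (\<lambda>x. (?k * cos (?k * x))\<^sup>2) = ?k\<^sup>2 * a"
      by (simp only: power_mult_distrib integral_mult_right I(2))
    show "smooth ?f" by (rule smooth_sin_ridge)
    show "edge_integral a b ?f = 0"
      using I(3) by (simp add: edge_integral_def flip: mult_2)
    show "integral (cbox (-a, -b) (a, b)) (\<lambda>z. (?f z)\<^sup>2) = 2 * a * b"
      by (subst integral_cbox_iterated(2)) (use I(1) ab in \<open>auto intro!: continuous_intros\<close>)
    show "integral (cbox (-a, -b) (a, b)) (\<lambda>z. (partial_deriv (1, 0) ?f z)\<^sup>2 + (partial_deriv (0, 1) ?f z)\<^sup>2) = ?k\<^sup>2 * (2 * a * b)"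
      unfolding partial_deriv_sin_ridge
      by (subst integral_cbox_iterated(2)) (use J ab in \<open>auto intro!: continuous_intros\<close>)
  qed (use ab in simp)
  then show "2 * a / pi \<le> C" by simp
  have "1 / (pi / (2 * b)) \<le> C"
  proof (rule key)
    let ?k = "pi / (2 * b)" and ?f = "\<lambda>z :: real \<times> real. sin ((0, pi / (2 * b)) \<bullet> z)"
    have k: "?k * (2 * b) = pi" using ab by simp
    note I = integral_sin_cos_squared[OF ab(2) k]
    have J: "integral {-b..b} (\<lambda>x. (?k * cos (?k * x))\<^sup>2) = ?k\<^sup>2 * b"
      by (simp only: power_mult_distrib integral_mult_right I(2))
    show "smooth ?f" by (rule smooth_sin_ridge)
    show "edge_integral a b ?f = 0"
      using I(3) by (simp add: edge_integral_def flip: mult_2)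
    show "integral (cbox (-a, -b) (a, b)) (\<lambda>z. (?f z)\<^sup>2) = 2 * a * b"
      by (subst integral_cbox_iterated(1)) (use I(1) ab in \<open>auto intro!: continuous_intros\<close>)
    show "integral (cbox (-a, -b) (a, b)) (\<lambda>z. (partial_deriv (1, 0) ?f z)\<^sup>2 + (partial_deriv (0, 1) ?f z)\<^sup>2) = ?k\<^sup>2 * (2 * a * b)"
      unfolding partial_deriv_sin_ridge
      by (subst integral_cbox_iterated(1)) (use J ab in \<open>auto intro!: continuous_intros\<close>)
  qed (use ab in simp)
  then show "2 * b / pi \<le> C" by simp
qed

section \<open>The sharp constant\<close>

theorem theorem2p1:
  fixes h1 h2 :: real and \<Omega> :: "(real \<times> real) set" and \<Gamma> :: "(real \<times> real) set"
  assumes "h1 > 0" and "h2 > 0"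
    and "\<Omega> = {-(h1/2)<..<h1/2} \<times> {-(h2/2)<..<h2/2}"
    and "\<Gamma> = frontier \<Omega>"
  shows "is_sharp_constant \<Omega> \<Gamma> (1 / pi * max h1 h2)"
proof -
  have \<Omega>: "\<Omega> = box (- (h1/2), - (h2/2)) (h1/2, h2/2)"
    unfolding assms(3) by (rule rectangle_eq_box)
  define k where "k = pi / max h1 h2"
  have k: "0 < k" "k * (2 * (h1/2)) \<le> pi" "k * (2 * (h2/2)) \<le> pi"
    using assms(1,2) by (auto simp: k_def divide_simps max_def)
  have "poincare_bound \<Omega> \<Gamma> (1 / k)"
    unfolding assms(4) \<Omega> by (rule poincare_bound_rectangle[OF _ _ k]) (use assms in auto)
  moreover have "1 / k = 1 / pi * max h1 h2" by (simp add: k_def)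
  moreover have "1 / pi * max h1 h2 \<le> C" if "poincare_bound \<Omega> \<Gamma> C" for C
    using poincare_bound_lower[of "h1/2" "h2/2" C] that assms(1,2) unfolding assms(4) \<Omega> by (simp add: max_def)
  ultimately show ?thesis unfolding is_sharp_constant_def by simp
qed

end
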